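(* Choose a set of positive weights $w=(w_1,\dots,w_N)$, and let $V_1=\min_{\pi\in\Pi_{\mathrm{stat}}}\max_{j\in C_0}w_jV(j;\pi)$. If $V_1>0$ then the queue length process $X(t)$ is transient under any stationary Markov routing policy. If $V_1<0$ then the queue length process $X(t)$ is positive recurrent under the JLW policy with weights $w$ and under any $\pi\in\Pi_K$.
   Context: Model. $C_0=\{1,\dots,N\}$ is a finite set of stations; station $j$ has service rate $\mu_j>0$. There is a finite collection of non-empty sets (neighbourhoods) $S_i\subseteq C_0$ with arrival rates $\lambda_i\ge 0$; $\mathcal{N}(C_0)$ denotes the collection of neighbourhoods with $\lambda_i>0$, and one writes $i\in\mathcal{N}(C_0)$ for $S_i\in\mathcal{N}(C_0)$. The bipartite graph with nodes $\mathcal{N}(C_0)\cup C_0$ and edges $\{(S_i,j):j\in S_i\}$ is assumed connected. Policies. A stationary Markov routing policy $\pi$ assigns to each state $x\in\mathbb{Z}^N$ and each $i\in\mathcal{N}(C_0)$ a probability vector $\pi(x,i)=(\pi(x,i)_j)_{j\in C_0}$ with $\pi(x,i)_j=0$ for $j\notin S_i$. It is static if it does not depend on $x$, and then one writes $\pi(i)$; $\Pi_{\mathrm{stat}}$ is the set of static policies. The JLW (join the least weighted queue) policy with positive weights $w$ is: $\pi(x,i)_j=1/|\mathcal{B}_i(x)|$ if $j\in\mathcal{B}_i(x)$ and $0$ otherwise, where $\mathcal{B}_i(x)=\{j\in S_i: w_jx_j=\min_{l\in S_i}w_lx_l\}$. Queue length process. Under policy $\pi$, $X(t)$ is the continuous-time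 Markov chain on $\mathbb{N}^N$ ($\mathbb{N}=\{0,1,2,\dots\}$) with jumps $x\mapsto x+e_j$ at rate $\sum_{i\in\mathcal{N}(C_0):\,j\in S_i}\lambda_i\pi(x,i)_j$ and $x\mapsto x-e_j$ at rate $\mu_j$ when $x_j\ge1$, where $e_j$ is the $j$-th unit vector. Drifts and clusters. For $\pi\in\Pi_{\mathrm{stat}}$, $V(j;\pi)=\sum_{i\in\mathcal{N}(C_0)}\lambda_i\pi(i)_j-\mu_j$. The hierarchical minimax decomposition for weights $w$ is defined recursively: $\Pi_0=\Pi_{\mathrm{stat}}$, $D_1=C_0$; for $k\ge1$ with $D_k\ne\emptyset$, $V_k=\min_{\pi\in\Pi_{k-1}}\max_{j\in D_k}w_jV(j;\pi)$; $C_k\subseteq D_k$ is the (unique) set of minimal cardinality among the sets $\{j\in D_k:w_jV(j;\pi)=V_k\}$, with $\pi$ ranging over the policies in $\Pi_{k-1}$ attaining this minimum; $\Pi_k=\{\pi\in\Pi_{k-1}:\max_{j\in C_k}w_jV(j;\pi)=V_k\}$; $D_{k+1}=D_k\setminus C_k$. The procedure stops at the stage $K\le N$ with $D_{K+1}=\emptyset$, so $C_1,\dots,C_K$ partition $C_0$. Thus $\Pi_K$ is the set of static policies achieving $V_k$ on $C_k$ for every $k=1,\dots,K$. *)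

theory Defs
  imports "HOL-Probability.Probability"
begin

section \<open>Continuous-time Markov chains\<close>

text \<open>A chain is given by its off-diagonal jump rates \<open>q x y\<close>, the rate of the jump
  from \<open>x\<close> to \<open>y \<noteq> x\<close>; the diagonal values \<open>q x x\<close> are meant to be \<open>0\<close>.\<close>

definition exit_rate :: "('x \<Rightarrow> 'x \<Rightarrow> real) \<Rightarrow> 'x \<Rightarrow> real" where
  "exit_rate q x = (\<Sum>\<^sub>\<infinity>y. q x y)"

definition jump_prob :: "('x \<Rightarrow> 'x \<Rightarrow> real) \<Rightarrow> 'x \<Rightarrow> 'x \<Rightarrow> real" where
  "jump_prob q x y = (if exit_rate q x = 0 then of_bool (y = x) else q x y / exit_rate q x)"

text \<open>
  \<open>X\<close> is, on the probability space \<open>M\<close>, a chain with jump rates \<open>q\<close> started in \<open>x\<close>. This is the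
  description by jump chain and holding times: \<open>Y\<close> is a discrete-time Markov chain with
  transition matrix \<open>jump_prob q\<close>, and given \<open>Y\<close> the holding times \<open>T n\<close> are independent and
  exponentially distributed with parameter \<open>exit_rate q (Y n)\<close>. A holding time with
  parameter \<open>0\<close> is almost surely infinite, so an absorbing state is never left.
  The definition puts no condition on \<open>X\<close> after an explosion of the jump times; when the exit
  rates are bounded, as for the queue lengths below, there is almost surely no explosion.
\<close>

definition markov_jump_process ::
    "('x \<Rightarrow> 'x \<Rightarrow> real) \<Rightarrow> 'x \<Rightarrow> 'a measure \<Rightarrow> (real \<Rightarrow> 'a \<Rightarrow> 'x) \<Rightarrow> bool" where
  "markov_jump_process q x M X \<longleftrightarrow>
     prob_space M \<and>
     (\<forall>t\<ge>0. X t \<in> measurable M (count_space UNIV)) \<and>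
     (\<exists>(Y :: nat \<Rightarrow> 'a \<Rightarrow> 'x) (T :: nat \<Rightarrow> 'a \<Rightarrow> ennreal).
        (\<forall>n. Y n \<in> measurable M (count_space UNIV)) \<and>
        (\<forall>n. T n \<in> borel_measurable M) \<and>
        (\<forall>n y s. (\<forall>k. 0 \<le> s k) \<longrightarrow>
           measure M {\<omega> \<in> space M. \<forall>k\<le>n. Y k \<omega> = y k \<and> ennreal (s k) < T k \<omega>} =
             of_bool (y 0 = x) * (\<Prod>k<n. jump_prob q (y k) (y (Suc k))) *
             (\<Prod>k\<le>n. exp (- exit_rate q (y k) * s k))) \<and>
        (AE \<omega> in M. \<forall>t\<ge>0. \<forall>n.
           (\<Sum>k<n. T k \<omega>) \<le> ennreal t \<and> ennreal t < (\<Sum>k<Suc n. T k \<omega>) \<longrightarrow> X t \<omega> = Y n \<omega>))"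

text \<open>The chain started in each possible state: \<open>M x\<close> plays the role of the law given \<open>X 0 = x\<close>.\<close>

definition markov_jump_family ::
    "('x \<Rightarrow> 'x \<Rightarrow> real) \<Rightarrow> ('x \<Rightarrow> 'a measure) \<Rightarrow> (real \<Rightarrow> 'a \<Rightarrow> 'x) \<Rightarrow> bool" where
  "markov_jump_family q M X \<longleftrightarrow> (\<forall>x. markov_jump_process q x (M x) X)"

subsection \<open>Transience and positive recurrence\<close>

definition transient_state :: "('x \<Rightarrow> 'a measure) \<Rightarrow> (real \<Rightarrow> 'a \<Rightarrow> 'x) \<Rightarrow> 'x \<Rightarrow> bool" where
  "transient_state M X x \<longleftrightarrow> (AE \<omega> in M x. bdd_above {t. 0 \<le> t \<and> X t \<omega> = x})"

definition transient_chain :: "('x \<Rightarrow> 'a measure) \<Rightarrow> (real \<Rightarrow> 'a \<Rightarrow> 'x) \<Rightarrow> bool" where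
  "transient_chain M X \<longleftrightarrow> (\<forall>x. transient_state M X x)"

text \<open>The first return time to \<open>x\<close> is the first time in \<open>x\<close> after having been elsewhere;
  it is infinite (the infimum of the empty set) if there is no return.\<close>

definition return_time :: "(real \<Rightarrow> 'a \<Rightarrow> 'x) \<Rightarrow> 'x \<Rightarrow> 'a \<Rightarrow> ennreal" where
  "return_time X x \<omega> =
     Inf (ennreal ` {t. X t \<omega> = x \<and> (\<exists>s. 0 \<le> s \<and> s < t \<and> X s \<omega> \<noteq> x)})"

definition positive_recurrent_state ::
    "('x \<Rightarrow> 'x \<Rightarrow> real) \<Rightarrow> ('x \<Rightarrow> 'a measure) \<Rightarrow> (real \<Rightarrow> 'a \<Rightarrow> 'x) \<Rightarrow> 'x \<Rightarrow> bool" where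
  "positive_recurrent_state q M X x \<longleftrightarrow>
     exit_rate q x = 0 \<or> (\<integral>\<^sup>+\<omega>. return_time X x \<omega> \<partial>M x) < \<infinity>"

definition leads_to :: "('x \<Rightarrow> 'x \<Rightarrow> real) \<Rightarrow> 'x \<Rightarrow> 'x \<Rightarrow> bool" where
  "leads_to q = (\<lambda>x y. 0 < q x y)\<^sup>*\<^sup>*"

definition closed_class :: "('x \<Rightarrow> 'x \<Rightarrow> real) \<Rightarrow> 'x set \<Rightarrow> bool" where
  "closed_class q R \<longleftrightarrow> R \<noteq> {} \<and> (\<forall>x\<in>R. {y. leads_to q x y} = R)"

text \<open>
  A chain need not be irreducible: a static policy may never use some station, and the states
  with a positive queue there are then inessential. Positive recurrence therefore
  means that the chain, from any initial state, almost surely enters one and the same closed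
  communicating class, all of whose states are positive recurrent. For irreducible
  chains this says that every state is positive recurrent, see
  \<open>positive_recurrent_chain_irreducible\<close> below.
\<close>

definition positive_recurrent_chain ::
    "('x \<Rightarrow> 'x \<Rightarrow> real) \<Rightarrow> ('x \<Rightarrow> 'a measure) \<Rightarrow> (real \<Rightarrow> 'a \<Rightarrow> 'x) \<Rightarrow> bool" where
  "positive_recurrent_chain q M X \<longleftrightarrow>
     (\<exists>R. closed_class q R \<and>
          (\<forall>x\<in>R. positive_recurrent_state q M X x) \<and>
          (\<forall>x. AE \<omega> in M x. \<exists>t\<ge>0. X t \<omega> \<in> R))"

lemma positive_recurrent_chain_irreducible:
  assumes "\<And>x y. leads_to q x y"
  shows "positive_recurrent_chain q M X \<longleftrightarrow> (\<forall>x. positive_recurrent_state q M X x)"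
proof -
  have "closed_class q R \<longleftrightarrow> R = UNIV" for R
    using assms by (auto simp: closed_class_def)
  then show ?thesis
    by (auto simp: positive_recurrent_chain_def intro: exI[of _ 0])
qed


section \<open>Stations, neighbourhoods and routing policies\<close>

text \<open>Stations are the elements of a finite type \<open>'s\<close>, so \<open>UNIV :: 's set\<close> is the whole set of
  stations and \<open>N = CARD('s)\<close>; neighbourhoods are indexed by a finite set \<open>I\<close>.\<close>

definition active :: "'i set \<Rightarrow> ('i \<Rightarrow> real) \<Rightarrow> 'i set" where
  "active I lam = {i \<in> I. 0 < lam i}"

definition bipartite_edges :: "'i set \<Rightarrow> ('i \<Rightarrow> 's set) \<Rightarrow> (('i + 's) \<times> ('i + 's)) set" where
  "bipartite_edges A S = {(Inl i, Inr j) | i j. i \<in> A \<and> j \<in> S i}"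

definition bipartite_connected :: "'i set \<Rightarrow> ('i \<Rightarrow> 's set) \<Rightarrow> bool" where
  "bipartite_connected A S \<longleftrightarrow>
     (\<forall>u \<in> A <+> UNIV. \<forall>v \<in> A <+> UNIV.
        (u, v) \<in> (bipartite_edges A S \<union> (bipartite_edges A S)\<inverse>)\<^sup>*)"

definition static_policies :: "'i set \<Rightarrow> ('i \<Rightarrow> 's::finite set) \<Rightarrow> ('i \<Rightarrow> 's \<Rightarrow> real) set" where
  "static_policies A S =
     {p. \<forall>i\<in>A. (\<forall>j. 0 \<le> p i j) \<and> (\<Sum>j\<in>UNIV. p i j) = 1 \<and> (\<forall>j. j \<notin> S i \<longrightarrow> p i j = 0)}"

definition routing_policy ::
    "'i set \<Rightarrow> ('i \<Rightarrow> 's::finite set) \<Rightarrow> (('s \<Rightarrow> int) \<Rightarrow> 'i \<Rightarrow> 's \<Rightarrow> real) \<Rightarrow> bool" where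
  "routing_policy A S \<pi> \<longleftrightarrow> (\<forall>x. \<pi> x \<in> static_policies A S)"

definition shortest :: "('i \<Rightarrow> 's set) \<Rightarrow> ('s \<Rightarrow> real) \<Rightarrow> ('s \<Rightarrow> int) \<Rightarrow> 'i \<Rightarrow> 's set" where
  "shortest S w x i =
     {j \<in> S i. w j * real_of_int (x j) = Min ((\<lambda>l. w l * real_of_int (x l)) ` S i)}"

definition JLW :: "('i \<Rightarrow> 's set) \<Rightarrow> ('s \<Rightarrow> real) \<Rightarrow> ('s \<Rightarrow> int) \<Rightarrow> 'i \<Rightarrow> 's \<Rightarrow> real" where
  "JLW S w x i j =
     (if j \<in> shortest S w x i then 1 / real (card (shortest S w x i)) else 0)"

definition arrival_rate ::
    "'i set \<Rightarrow> ('i \<Rightarrow> 's set) \<Rightarrow> ('i \<Rightarrow> real) \<Rightarrow> (('s \<Rightarrow> int) \<Rightarrow> 'i \<Rightarrow> 's \<Rightarrow> real) \<Rightarrow>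
     ('s \<Rightarrow> nat) \<Rightarrow> 's \<Rightarrow> real" where
  "arrival_rate A S lam \<pi> x j = (\<Sum>i\<in>{i\<in>A. j \<in> S i}. lam i * \<pi> (\<lambda>l. int (x l)) i j)"

text \<open>At most one summand below is non-zero, since the states \<open>x + e\<^sub>j\<close> and \<open>x - e\<^sub>j\<close> are
  pairwise different.\<close>

definition queue_rates ::
    "'i set \<Rightarrow> ('i \<Rightarrow> 's::finite set) \<Rightarrow> ('i \<Rightarrow> real) \<Rightarrow> ('s \<Rightarrow> real) \<Rightarrow>
     (('s \<Rightarrow> int) \<Rightarrow> 'i \<Rightarrow> 's \<Rightarrow> real) \<Rightarrow> ('s \<Rightarrow> nat) \<Rightarrow> ('s \<Rightarrow> nat) \<Rightarrow> real" where
  "queue_rates A S lam mu \<pi> x y =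
     (\<Sum>j\<in>UNIV. (if y = x(j := x j + 1) then arrival_rate A S lam \<pi> x j else 0) +
                (if 1 \<le> x j \<and> y = x(j := x j - 1) then mu j else 0))"


section \<open>The hierarchical minimax decomposition\<close>

definition drift ::
    "'i set \<Rightarrow> ('i \<Rightarrow> real) \<Rightarrow> ('s \<Rightarrow> real) \<Rightarrow> 's \<Rightarrow> ('i \<Rightarrow> 's \<Rightarrow> real) \<Rightarrow> real" where
  "drift A lam mu j p = (\<Sum>i\<in>A. lam i * p i j) - mu j"

text \<open>The functions below take the weighted drift \<open>f j p = w j * V(j; p)\<close> as a parameter.\<close>

definition max_drift :: "('s \<Rightarrow> 'p \<Rightarrow> real) \<Rightarrow> 's set \<Rightarrow> 'p \<Rightarrow> real" where
  "max_drift f D p = Max ((\<lambda>j. f j p) ` D)"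

definition minimax :: "('s \<Rightarrow> 'p \<Rightarrow> real) \<Rightarrow> 'p set \<Rightarrow> 's set \<Rightarrow> real" where
  "minimax f P D = (LEAST v. v \<in> max_drift f D ` P)"

definition critical_sets :: "('s \<Rightarrow> 'p \<Rightarrow> real) \<Rightarrow> 'p set \<Rightarrow> 's set \<Rightarrow> 's set set" where
  "critical_sets f P D =
     {{j \<in> D. f j p = minimax f P D} | p. p \<in> P \<and> max_drift f D p = minimax f P D}"

definition cluster :: "('s \<Rightarrow> 'p \<Rightarrow> real) \<Rightarrow> 'p set \<Rightarrow> 's set \<Rightarrow> 's set" where
  "cluster f P D = (THE C. is_arg_min card (\<lambda>C. C \<in> critical_sets f P D) C)"

text \<open>\<open>decomposition f P0 k\<close> is the pair of \<open>\<Pi>\<^sub>k\<close> and \<open>D\<^sub>k\<^sub>+\<^sub>1\<close>.\<close>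

primrec decomposition ::
    "('s \<Rightarrow> 'p \<Rightarrow> real) \<Rightarrow> 'p set \<Rightarrow> nat \<Rightarrow> 'p set \<times> 's set" where
  "decomposition f P0 0 = (P0, UNIV)"
| "decomposition f P0 (Suc k) =
     (let (P, D) = decomposition f P0 k; C = cluster f P D
      in ({p \<in> P. max_drift f C p = minimax f P D}, D - C))"

definition final_stage :: "('s \<Rightarrow> 'p \<Rightarrow> real) \<Rightarrow> 'p set \<Rightarrow> nat" where
  "final_stage f P0 = (LEAST k. snd (decomposition f P0 k) = {})"

definition final_policies :: "('s \<Rightarrow> 'p \<Rightarrow> real) \<Rightarrow> 'p set \<Rightarrow> 'p set" where
  "final_policies f P0 = fst (decomposition f P0 (final_stage f P0))"


section \<open>Existence of the processes\<close>

text \<open>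
  Families of processes with the rates of a routing policy exist: \<open>\<omega> (n, x)\<close> carries the
  holding time in \<open>x\<close> and the successor of \<open>x\<close> that are used if the \<open>n\<close>-th state
  of the jump chain is \<open>x\<close>, independently for all \<open>(n, x)\<close>.
\<close>

locale jump_construction =
  fixes q :: "'x::countable \<Rightarrow> 'x \<Rightarrow> real"
  assumes nonneg: "0 \<le> q x y" and fin: "finite {y. q x y \<noteq> 0}"
begin

lemma exit_rate_sum: "exit_rate q x = (\<Sum>y | q x y \<noteq> 0. q x y)"
proof -
  have "exit_rate q x = infsum (q x) {y. q x y \<noteq> 0}"
    unfolding exit_rate_def by (rule infsum_cong_neutral) auto
  then show ?thesis using fin by simp
qed

lemma exit_rate_nonneg: "0 \<le> exit_rate q x"
  by (simp add: exit_rate_sum sum_nonneg nonneg)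

definition step :: "'x \<Rightarrow> 'x pmf" where
  "step x = embed_pmf (jump_prob q x)"

lemma pmf_step: "pmf (step x) y = jump_prob q x y"
  unfolding step_def
proof (rule pmf_embed_pmf)
  show nn: "0 \<le> jump_prob q x y" for y
    by (simp add: jump_prob_def nonneg exit_rate_nonneg)
  let ?F = "insert x {y. q x y \<noteq> 0}"
  have "(\<integral>\<^sup>+y. ennreal (jump_prob q x y) \<partial>count_space UNIV) = (\<Sum>y\<in>?F. ennreal (jump_prob q x y))"
    using fin[of x] by (intro nn_integral_count_space') (auto simp: jump_prob_def)
  also have "\<dots> = ennreal (\<Sum>y\<in>?F. jump_prob q x y)"
    using nn by simp
  also have "(\<Sum>y\<in>?F. jump_prob q x y) = 1"
  proof (cases "exit_rate q x = 0")
    case True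
    then show ?thesis using fin[of x] by (simp add: jump_prob_def of_bool_def)
  next
    case False
    have "(\<Sum>y\<in>?F. jump_prob q x y) = (\<Sum>y | q x y \<noteq> 0. jump_prob q x y)"
      using fin[of x] False by (intro sum.mono_neutral_right) (auto simp: jump_prob_def)
    also have "\<dots> = 1"
      using False by (simp add: jump_prob_def exit_rate_sum flip: sum_divide_distrib)
    finally show ?thesis .
  qed
  finally show "(\<integral>\<^sup>+y. ennreal (jump_prob q x y) \<partial>count_space UNIV) = 1" by simp
qed

definition hold :: "'x \<Rightarrow> ennreal measure" where
  "hold x = (if exit_rate q x = 0 then return borel \<infinity>
     else distr (density lborel (exponential_density (exit_rate q x))) borel ennreal)"

lemma sets_hold [simp, measurable_cong]: "sets (hold x) = sets borel"
  by (simp add: hold_def)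

lemma prob_space_hold: "prob_space (hold x)"
  using exit_rate_nonneg[of x] unfolding hold_def
  by (auto intro!: prob_space.prob_space_distr prob_space_return prob_space_exponential_density
      simp: less_le)

lemma measure_hold:
  assumes "0 \<le> s" shows "measure (hold x) {ennreal s<..} = exp (- exit_rate q x * s)"
proof (cases "exit_rate q x = 0")
  case True
  then show ?thesis by (simp add: hold_def measure_return)
next
  case False
  then have pos: "0 < exit_rate q x" using exit_rate_nonneg[of x] by simp
  let ?D = "density lborel (exponential_density (exit_rate q x))"
  interpret prob_space ?D by (rule prob_space_exponential_density[OF pos])
  have "distributed ?D lborel (\<lambda>x. x) (exponential_density (exit_rate q x))"
    by (auto simp: distributed_def distr_id2)
  from exponential_distributedD_gt[OF this assms pos]
  have "\<P>(y in ?D. s < y) = exp (- s * exit_rate q x)" .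
  moreover have "ennreal -` {ennreal s<..} \<inter> space ?D = {y \<in> space ?D. s < y}"
    using assms by (auto simp: ennreal_less_iff)
  ultimately show ?thesis
    using False by (simp add: hold_def measure_distr mult.commute)
qed

abbreviation choice :: "nat \<times> 'x \<Rightarrow> ('x \<times> ennreal) measure" where
  "choice z \<equiv> measure_pmf (step (snd z)) \<Otimes>\<^sub>M hold (snd z)"

lemma prob_space_choice: "prob_space (choice z)"
  by (intro prob_space_pair prob_space_hold prob_space_measure_pmf)

definition \<Omega> :: "(nat \<times> 'x \<Rightarrow> 'x \<times> ennreal) measure" where
  "\<Omega> = Pi\<^sub>M UNIV choice"

sublocale product_prob_space choice UNIV
  by (intro product_prob_spaceI prob_space_choice)

primrec Y :: "'x \<Rightarrow> nat \<Rightarrow> (nat \<times> 'x \<Rightarrow> 'x \<times> ennreal) \<Rightarrow> 'x" where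
  "Y x 0 \<omega> = x"
| "Y x (Suc n) \<omega> = fst (\<omega> (n, Y x n \<omega>))"

definition T :: "'x \<Rightarrow> nat \<Rightarrow> (nat \<times> 'x \<Rightarrow> 'x \<times> ennreal) \<Rightarrow> ennreal" where
  "T x n \<omega> = snd (\<omega> (n, Y x n \<omega>))"

lemma coord: "(\<lambda>\<omega>. fst (\<omega> z)) \<in> measurable \<Omega> (count_space UNIV)"
  "(\<lambda>\<omega>. snd (\<omega> z)) \<in> borel_measurable \<Omega>"
proof -
  have c: "(\<lambda>\<omega>. \<omega> z) \<in> measurable \<Omega> (choice z)"
    unfolding \<Omega>_def by simp
  from measurable_compose[OF c measurable_fst]
  show "(\<lambda>\<omega>. fst (\<omega> z)) \<in> measurable \<Omega> (count_space UNIV)" by simp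
  from measurable_compose[OF c measurable_snd]
  show "(\<lambda>\<omega>. snd (\<omega> z)) \<in> borel_measurable \<Omega>" by (simp cong: measurable_cong_sets)
qed

lemma Y_measurable [measurable]: "Y x n \<in> measurable \<Omega> (count_space UNIV)"
proof (induction n)
  case (Suc n)
  have "(\<lambda>\<omega>. fst (\<omega> (n, Y x n \<omega>))) \<in> measurable \<Omega> (count_space UNIV)"
    by (rule measurable_compose_countable[OF coord(1) Suc])
  then show ?case by (simp cong: measurable_cong)
qed simp

lemma T_measurable [measurable]: "T x n \<in> borel_measurable \<Omega>"
  unfolding T_def by (rule measurable_compose_countable[OF coord(2) Y_measurable])

lemma Y_T_law:
  assumes s: "\<And>k. 0 \<le> s k"
  shows "measure \<Omega> {\<omega> \<in> space \<Omega>. \<forall>k\<le>n. Y x k \<omega> = y k \<and> ennreal (s k) < T x k \<omega>} =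
    of_bool (y 0 = x) * (\<Prod>k<n. jump_prob q (y k) (y (Suc k))) *
    (\<Prod>k\<le>n. exp (- exit_rate q (y k) * s k))"
proof (cases "y 0 = x")
  case False
  then have "{\<omega> \<in> space \<Omega>. \<forall>k\<le>n. Y x k \<omega> = y k \<and> ennreal (s k) < T x k \<omega>} = {}"
    by (auto dest: spec[of _ 0])
  then show ?thesis using False by (simp only:) simp
next
  case y0: True
  define J where "J = (\<lambda>k. (k, y k)) ` {..n}"
  define B where "B z = (if fst z < n then {y (Suc (fst z))} else UNIV) \<times> {ennreal (s (fst z))<..}"
    for z :: "nat \<times> 'x"
  have inj: "inj_on (\<lambda>k. (k, y k)) {..n}" by (auto simp: inj_on_def)
  have B_sets: "B z \<in> sets (choice z)" for z
    unfolding B_def by (intro pair_measureI) auto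
  have "(\<forall>k\<le>m. Y x k \<omega> = y k \<and> ennreal (s k) < T x k \<omega>) \<longleftrightarrow>
      (\<forall>k<m. fst (\<omega> (k, y k)) = y (Suc k)) \<and> (\<forall>k\<le>m. ennreal (s k) < snd (\<omega> (k, y k)))"
    for m \<omega>
  proof (induction m)
    case 0
    then show ?case using y0 by (simp add: T_def)
  next
    case (Suc m)
    have Ym: "Y x m \<omega> = y m" if "\<forall>k\<le>m. Y x k \<omega> = y k \<and> ennreal (s k) < T x k \<omega>" using that by auto
    show ?case
      unfolding le_Suc_eq less_Suc_eq all_conj_distrib disj_imp using Suc Ym
      by (auto simp: T_def)
  qed
  note ev = this
  have "(\<forall>z\<in>J. \<omega> z \<in> B z) \<longleftrightarrow>
      (\<forall>k<n. fst (\<omega> (k, y k)) = y (Suc k)) \<and> (\<forall>k\<le>n. ennreal (s k) < snd (\<omega> (k, y k)))" for \<omega>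
  proof -
    have "(\<forall>z\<in>J. \<omega> z \<in> B z) \<longleftrightarrow> (\<forall>k\<in>{..n}. \<omega> (k, y k) \<in> B (k, y k))"
      unfolding J_def by blast
    also have "\<dots> \<longleftrightarrow>
        (\<forall>k\<le>n. (k < n \<longrightarrow> fst (\<omega> (k, y k)) = y (Suc k)) \<and> ennreal (s k) < snd (\<omega> (k, y k)))"
      unfolding Ball_def B_def mem_Times_iff by (intro all_cong1) simp
    also have "\<dots> \<longleftrightarrow>
        (\<forall>k<n. fst (\<omega> (k, y k)) = y (Suc k)) \<and> (\<forall>k\<le>n. ennreal (s k) < snd (\<omega> (k, y k)))"
      using less_imp_le by blast
    finally show ?thesis .
  qed
  with ev have "{\<omega> \<in> space \<Omega>. \<forall>k\<le>n. Y x k \<omega> = y k \<and> ennreal (s k) < T x k \<omega>} =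
      {\<omega> \<in> space \<Omega>. \<forall>z\<in>J. \<omega> z \<in> B z}"
    by simp
  then have "emeasure \<Omega> {\<omega> \<in> space \<Omega>. \<forall>k\<le>n. Y x k \<omega> = y k \<and> ennreal (s k) < T x k \<omega>} =
      (\<Prod>z\<in>J. emeasure (choice z) (B z))"
    using emeasure_PiM_Collect[of J B] B_sets by (simp add: \<Omega>_def J_def)
  then have "measure \<Omega> {\<omega> \<in> space \<Omega>. \<forall>k\<le>n. Y x k \<omega> = y k \<and> ennreal (s k) < T x k \<omega>} =
      (\<Prod>z\<in>J. measure (choice z) (B z))"
    by (intro measure_eq_emeasure_eq_ennreal prod_nonneg)
       (simp_all add: M.emeasure_eq_measure prod_ennreal)
  also have "\<dots> = (\<Prod>k\<le>n. measure (choice (k, y k)) (B (k, y k)))"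
    unfolding J_def by (simp add: prod.reindex[OF inj])
  also have "\<dots> = (\<Prod>k\<le>n. (if k < n then jump_prob q (y k) (y (Suc k)) else 1) *
      exp (- exit_rate q (y k) * s k))"
  proof (rule prod.cong[OF refl])
    fix k
    interpret H: prob_space "hold (y k)" by (rule prob_space_hold)
    interpret HP: pair_prob_space "measure_pmf (step (y k))" "hold (y k)" ..
    have "measure (choice (k, y k)) (B (k, y k)) =
        measure (step (y k)) (if k < n then {y (Suc k)} else UNIV) *
        measure (hold (y k)) {ennreal (s k)<..}"
      unfolding B_def by (simp add: measure_def H.emeasure_pair_measure_Times enn2real_mult)
    also have "\<dots> = (if k < n then jump_prob q (y k) (y (Suc k)) else 1) *
        exp (- exit_rate q (y k) * s k)"
      using s by (simp add: measure_hold pmf_step measure_pmf_single)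
    finally show "measure (choice (k, y k)) (B (k, y k)) =
        (if k < n then jump_prob q (y k) (y (Suc k)) else 1) * exp (- exit_rate q (y k) * s k)" .
  qed
  also have "\<dots> = (\<Prod>k\<le>n. if k < n then jump_prob q (y k) (y (Suc k)) else 1) *
      (\<Prod>k\<le>n. exp (- exit_rate q (y k) * s k))"
    by (rule prod.distrib)
  also have "(\<Prod>k\<le>n. if k < n then jump_prob q (y k) (y (Suc k)) else 1) =
      (\<Prod>k<n. jump_prob q (y k) (y (Suc k)))"
    by (simp add: lessThan_Suc_atMost[symmetric])
  finally show ?thesis using y0 by simp
qed

definition X :: "'x \<Rightarrow> real \<Rightarrow> (nat \<times> 'x \<Rightarrow> 'x \<times> ennreal) \<Rightarrow> 'x" where
  "X x t \<omega> = Y x (LEAST n. ennreal t < (\<Sum>k<Suc n. T x k \<omega>)) \<omega>"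

lemma X_eq:
  assumes le: "(\<Sum>k<n. T x k \<omega>) \<le> ennreal t" and lt: "ennreal t < (\<Sum>k<Suc n. T x k \<omega>)"
  shows "X x t \<omega> = Y x n \<omega>"
proof -
  have "(LEAST n. ennreal t < (\<Sum>k<Suc n. T x k \<omega>)) = n"
  proof (rule Least_equality, rule lt, rule ccontr)
    fix m assume m: "ennreal t < (\<Sum>k<Suc m. T x k \<omega>)" "\<not> n \<le> m"
    then have "(\<Sum>k<Suc m. T x k \<omega>) \<le> (\<Sum>k<n. T x k \<omega>)"
      by (intro sum_mono2) auto
    with m(1) have "ennreal t < (\<Sum>k<n. T x k \<omega>)" by (rule less_le_trans)
    with le show False by simp
  qed
  then show ?thesis by (simp add: X_def)
qed

abbreviation paths :: "('x \<times> (nat \<times> 'x \<Rightarrow> 'x \<times> ennreal)) measure" where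
  "paths \<equiv> count_space UNIV \<Otimes>\<^sub>M \<Omega>"

definition P_start :: "'x \<Rightarrow> ('x \<times> (nat \<times> 'x \<Rightarrow> 'x \<times> ennreal)) measure" where
  "P_start x = distr \<Omega> paths (Pair x)"

lemma paths_measurable:
  "(\<And>x. f x \<in> measurable \<Omega> N) \<Longrightarrow> (\<lambda>z. f (fst z) (snd z)) \<in> measurable paths N"
  by (intro measurable_compose_countable[where f = "\<lambda>x z. f x (snd z)" and g = fst])
     (auto intro: measurable_compose[OF measurable_snd])

lemma family: "markov_jump_family q P_start (\<lambda>t z. X (fst z) t (snd z))"
  unfolding markov_jump_family_def markov_jump_process_def
proof (intro allI conjI impI exI[of _ "\<lambda>n z. Y (fst z) n (snd z)"]
    exI[of _ "\<lambda>n z. T (fst z) n (snd z)"])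
  fix x
  show "prob_space (P_start x)"
    unfolding P_start_def by (rule prob_space.prob_space_distr) (auto simp: \<Omega>_def P.prob_space_axioms)
  have mP: "measurable (P_start x) N = measurable paths N" for N :: "'n measure"
    by (rule measurable_cong_sets) (auto simp: P_start_def)
  have "X y t \<in> measurable \<Omega> (count_space UNIV)" for y t
    unfolding X_def by (rule measurable_compose_countable[OF Y_measurable]) measurable
  then show "(\<lambda>z. X (fst z) t (snd z)) \<in> measurable (P_start x) (count_space UNIV)" for t
    unfolding mP by (intro paths_measurable)
  show mY: "(\<lambda>z. Y (fst z) n (snd z)) \<in> measurable (P_start x) (count_space UNIV)" for n
    unfolding mP by (intro paths_measurable Y_measurable)
  show mT: "(\<lambda>z. T (fst z) n (snd z)) \<in> borel_measurable (P_start x)" for n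
    unfolding mP by (intro paths_measurable T_measurable)
  show "measure (P_start x) {z \<in> space (P_start x).
        \<forall>k\<le>n. Y (fst z) k (snd z) = y k \<and> ennreal (s k) < T (fst z) k (snd z)} =
      of_bool (y 0 = x) * (\<Prod>k<n. jump_prob q (y k) (y (Suc k))) *
      (\<Prod>k\<le>n. exp (- exit_rate q (y k) * s k))" (is "measure _ ?E = _")
    if s: "\<forall>k. 0 \<le> s k" for n y and s :: "nat \<Rightarrow> real"
  proof -
    have "?E \<in> sets (P_start x)"
      using mY[measurable] mT[measurable] by measurable
    then have "measure (P_start x) ?E = measure \<Omega> (Pair x -` ?E \<inter> space \<Omega>)"
      unfolding P_start_def by (intro measure_distr) auto
    also have "Pair x -` ?E \<inter> space \<Omega> =
        {\<omega> \<in> space \<Omega>. \<forall>k\<le>n. Y x k \<omega> = y k \<and> ennreal (s k) < T x k \<omega>}"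
      by (auto simp: P_start_def space_pair_measure)
    finally show ?thesis using Y_T_law s by simp
  qed
  show "AE z in P_start x. \<forall>t\<ge>0. \<forall>n. (\<Sum>k<n. T (fst z) k (snd z)) \<le> ennreal t \<and>
      ennreal t < (\<Sum>k<Suc n. T (fst z) k (snd z)) \<longrightarrow> X (fst z) t (snd z) = Y (fst z) n (snd z)"
    using X_eq by auto
qed

end

lemma queue_rates_nonneg:
  assumes "\<And>i. i \<in> A \<Longrightarrow> 0 \<le> lam i" "\<And>j. 0 < mu j" "routing_policy A S \<pi>"
  shows "0 \<le> queue_rates A S lam mu \<pi> x y"
  using assms unfolding queue_rates_def arrival_rate_def routing_policy_def static_policies_def
  by (intro sum_nonneg add_nonneg_nonneg) (auto intro!: sum_nonneg mult_nonneg_nonneg simp: less_imp_le)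

lemma queue_rates_finite: "finite {y. queue_rates A S lam mu \<pi> x y \<noteq> 0}"
proof (rule finite_subset)
  let ?F = "range (\<lambda>j. x(j := x j + 1)) \<union> range (\<lambda>j. x(j := x j - 1))"
  show "{y. queue_rates A S lam mu \<pi> x y \<noteq> 0} \<subseteq> ?F"
  proof (rule subsetI, rule ccontr)
    fix y assume "y \<in> {y. queue_rates A S lam mu \<pi> x y \<noteq> 0}" and "y \<notin> ?F"
    then show False
      unfolding queue_rates_def by (auto simp: image_iff dest: sum.not_neutral_contains_not_neutral split: if_splits)
  qed
qed auto

theorem queue_process_exists:
  fixes S :: "'i \<Rightarrow> 's::finite set"
  assumes "\<And>i. i \<in> A \<Longrightarrow> 0 \<le> lam i" "\<And>j. 0 < mu j" "routing_policy A S \<pi>"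
  shows "\<exists>(M :: _ \<Rightarrow> (('s \<Rightarrow> nat) \<times> (nat \<times> ('s \<Rightarrow> nat) \<Rightarrow> ('s \<Rightarrow> nat) \<times> ennreal)) measure) X.
    markov_jump_family (queue_rates A S lam mu \<pi>) M X"
proof -
  interpret jump_construction "queue_rates A S lam mu \<pi>"
    by standard (use queue_rates_nonneg[OF assms] queue_rates_finite in auto)
  show ?thesis using family by blast
qed

end

theory Submission
  imports Defs
begin

text \<open>
  Both halves of the theorem follow from the drift of a suitable function of the queue lengths;
  the minimax value decides which function works.

  Suppose \<open>V\<^sub>1 > 0\<close>, and let \<open>C\<close> be the first cluster, the critical set of some minimizing policy
  \<open>p\<close>. If \<open>p\<close> routed some traffic of a neighbourhood \<open>S\<^sub>i\<close> into \<open>C\<close> although \<open>S\<^sub>i\<close> has a station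
  outside \<open>C\<close>, then moving that traffic out of \<open>C\<close> would lead to a smaller critical set or a
  smaller maximum, against the choice of \<open>C\<close> (\<open>minimal_critical_set_rigid\<close>). So all arrivals in
  \<open>C\<close> come from neighbourhoods contained in \<open>C\<close>, and they exceed the service capacity of \<open>C\<close> because
  every drift in \<open>C\<close> is positive (\<open>overloaded_cluster\<close>). No policy can send this traffic
  elsewhere. Hence the total queue \<open>n\<close> in \<open>C\<close> has positive drift under every policy, and for some
  \<open>\<theta> < 1\<close> close to \<open>1\<close> the expectation of \<open>\<theta>\<close> to the power \<open>n\<close> decays geometrically along the jump
  chain. By Borel-Cantelli every state is visited by finitely many jumps, and since bounded rates
  exclude explosion, the visits also end in continuous time (\<open>transient_chainI\<close>).

  Suppose \<open>V\<^sub>1 < 0\<close>. The generator maps the function \<open>\<Sum>\<^sub>j w\<^sub>j x\<^sub>j\<^sup>2\<close> to \<open>2 \<Sum>\<^sub>j w\<^sub>j x\<^sub>j (a\<^sub>j(x) - \<mu>\<^sub>j)\<close>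
  up to a bounded term, where \<open>a\<^sub>j(x)\<close> is the arrival rate at station \<open>j\<close>.
  A policy in \<open>\<Pi>\<^sub>K\<close> satisfies \<open>w\<^sub>j V(j) \<le> V\<^sub>1\<close> at every station, as no later stage
  has a value above \<open>V\<^sub>1\<close> (\<open>final_policies_drift_le\<close>). The JLW policy minimizes \<open>\<Sum>\<^sub>j w\<^sub>j x\<^sub>j a\<^sub>j(x)\<close> in every state \<open>x\<close> (\<open>JLW_workload_le\<close>), so that it does at least as
  well there as a minimizing static policy. In both cases the drift is at most
  \<open>2 V\<^sub>1 \<Sum>\<^sub>j x\<^sub>j\<close> plus a constant, hence at most \<open>-1\<close> outside a finite set.

  Foster's criterion turns this into positive recurrence (\<open>positive_recurrent_chainI\<close>). The finite
  exceptional set is first shrunk to a single state \<open>z\<close>, by a bounded correction of the Lyapunov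
  function that exploits that all states lead to \<open>z\<close> (\<open>Lyapunov_except_one_state\<close>). After that, the
  holding times spent until the first return to \<open>z\<close> have an expected sum that telescopes against the
  decrease of the Lyapunov function (\<open>nn_integral_excursion_finite\<close>).
\<close>

section \<open>Generator and path laws of a jump chain\<close>

definition rate_generator :: "('x \<Rightarrow> 'x \<Rightarrow> real) \<Rightarrow> ('x \<Rightarrow> real) \<Rightarrow> 'x \<Rightarrow> real" where
  "rate_generator q f x = (\<Sum>y | q x y \<noteq> 0. q x y * (f y - f x))"

text \<open>The states visited so far, the most recent one first. On such lists a step of the chain is a
  Cons, and the lists over a countable state space form a countable type, so that laws of
  histories are determined by singletons.\<close>

primrec history :: "nat \<Rightarrow> (nat \<Rightarrow> 'x) \<Rightarrow> 'x list" where
  "history 0 y = [y 0]"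
| "history (Suc n) y = y (Suc n) # history n y"

lemma history_not_Nil [simp]: "history n y \<noteq> []"
  by (cases n) auto

lemma hd_history [simp]: "hd (history n y) = y n"
  by (cases n) auto

lemma length_history [simp]: "length (history n y) = Suc n"
  by (induction n) auto

lemma history_eq_iff: "history n y = history n y' \<longleftrightarrow> (\<forall>k\<le>n. y k = y' k)"
  by (induction n) (auto simp: le_Suc_eq)

lemma history_surj: "length ys = Suc n \<Longrightarrow> \<exists>y. ys = history n y"
proof (induction n arbitrary: ys)
  case 0
  then show ?case by (auto simp: length_Suc_conv)
next
  case (Suc n)
  then obtain a ys' y where "ys = a # ys'" "ys' = history n y"
    by (metis length_Suc_conv)
  then have "ys = history (Suc n) (y(Suc n := a))"
    by (simp add: history_eq_iff)
  then show ?case by blast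
qed

text \<open>The last element of the list is the initial state; removing it leaves the states seen after
  at least one jump, which are those that count for a return.\<close>

lemma mem_butlast_history: "z \<in> set (butlast (history n y)) \<longleftrightarrow> (\<exists>k\<in>{1..n}. y k = z)"
  by (induction n) (auto simp: atLeastAtMostSuc_conv)

context jump_construction
begin

lemma rate_generator_conv:
  "rate_generator q f x = (\<Sum>y | q x y \<noteq> 0. q x y * f y) - f x * exit_rate q x"
  unfolding rate_generator_def exit_rate_sum sum_distrib_left sum_subtractf[symmetric]
  by (intro sum.cong) (auto simp: algebra_simps)

lemma exit_rate_pos:
  assumes "rate_generator q f x \<noteq> 0"
  shows "0 < exit_rate q x"
proof (rule ccontr)
  assume "\<not> 0 < exit_rate q x"
  then have "(\<Sum>y | q x y \<noteq> 0. q x y) = 0"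
    using exit_rate_nonneg[of x] by (simp add: exit_rate_sum)
  then have "\<forall>y\<in>{y. q x y \<noteq> 0}. q x y = 0"
    using fin nonneg by (subst (asm) sum_nonneg_eq_0_iff) auto
  then have "{y. q x y \<noteq> 0} = {}" by blast
  then show False using assms by (simp only: rate_generator_def sum.empty)
qed

text \<open>One step of the jump chain changes the mean of \<open>f\<close> by the generator divided by the exit rate,
  that is, by the generator times the mean holding time.\<close>

lemma sum_jump_prob_conv_rate_generator:
  assumes "0 < exit_rate q x"
  shows "(\<Sum>y | q x y \<noteq> 0. f y * jump_prob q x y) = f x + rate_generator q f x / exit_rate q x"
proof -
  have "(\<Sum>y | q x y \<noteq> 0. f y * jump_prob q x y) = (\<Sum>y | q x y \<noteq> 0. q x y * f y) / exit_rate q x"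
    using assms by (simp add: jump_prob_def sum_divide_distrib mult.commute)
  then show ?thesis
    using assms by (simp add: rate_generator_conv field_simps)
qed

lemma nn_integral_step:
  assumes "\<And>y. 0 \<le> f y" "0 < exit_rate q x"
  shows "(\<integral>\<^sup>+y. ennreal (f y) \<partial>step x) = ennreal (f x + rate_generator q f x / exit_rate q x)"
proof -
  have "(\<integral>\<^sup>+y. ennreal (f y) \<partial>step x) = (\<Sum>y | q x y \<noteq> 0. ennreal (f y) * ennreal (pmf (step x) y))"
    using assms fin[of x]
    by (intro nn_integral_measure_pmf_support) (auto simp: set_pmf_iff pmf_step jump_prob_def)
  also have "\<dots> = ennreal (\<Sum>y | q x y \<noteq> 0. f y * jump_prob q x y)"
    using assms(1) nonneg exit_rate_nonneg
    by (simp add: pmf_step[symmetric] ennreal_mult[symmetric] sum_nonneg)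
  also have "\<dots> = ennreal (f x + rate_generator q f x / exit_rate q x)"
    by (simp add: sum_jump_prob_conv_rate_generator[OF assms(2)])
  finally show ?thesis .
qed

primrec path :: "'x \<Rightarrow> nat \<Rightarrow> 'x list pmf" where
  "path x 0 = return_pmf [x]"
| "path x (Suc n) = bind_pmf (path x n) (\<lambda>ys. map_pmf (\<lambda>y. y # ys) (step (hd ys)))"

lemma length_path: "ys \<in> set_pmf (path x n) \<Longrightarrow> length ys = Suc n"
  by (induction n arbitrary: ys) auto

lemma pmf_path_Suc: "pmf (path x (Suc n)) (y # ys) = pmf (path x n) ys * jump_prob q (hd ys) y"
proof -
  have eq: "pmf (map_pmf (\<lambda>y. y # ys') (step (hd ys'))) (y # ys) =
      jump_prob q (hd ys) y * indicator {ys} ys'" for ys'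
    using pmf_map_inj'[of "\<lambda>y. y # ys" "step (hd ys)" y]
    by (cases "ys' = ys") (auto simp: inj_def pmf_step intro!: pmf_map_outside)
  then have "ennreal (pmf (path x (Suc n)) (y # ys)) =
      (\<integral>\<^sup>+ys'. ennreal (jump_prob q (hd ys) y) * indicator {ys} ys' \<partial>path x n)"
    unfolding path.simps ennreal_pmf_bind eq
    by (intro nn_integral_cong) (auto split: split_indicator)
  also have "\<dots> = ennreal (jump_prob q (hd ys) y) * ennreal (pmf (path x n) ys)"
    by (simp add: nn_integral_cmult_indicator emeasure_pmf_single)
  finally show ?thesis
    by (simp add: pmf_step[symmetric] ennreal_mult[symmetric] mult.commute del: path.simps)
qed

lemma pmf_path_history:
  "pmf (path x n) (history n y) = of_bool (y 0 = x) * (\<Prod>k<n. jump_prob q (y k) (y (Suc k)))"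
proof (induction n)
  case (Suc n)
  then show ?case
    by (simp add: pmf_path_Suc del: path.simps)
qed (auto simp: indicator_def)

lemma nn_integral_path_Suc:
  "(\<integral>\<^sup>+ys. F ys \<partial>path x (Suc n)) = (\<integral>\<^sup>+ys. \<integral>\<^sup>+y. F (y # ys) \<partial>step (hd ys) \<partial>path x n)"
  by simp

end

text \<open>A jump chain \<open>Z\<close> with holding times \<open>H\<close>, started in \<open>x0\<close>, as it occurs inside
  \<open>markov_jump_process\<close>. Only the probabilities that a path is followed with all holding times
  above given bounds are prescribed; the laws needed below are derived from them.\<close>

locale jump_law = jump_construction q + Pr: prob_space M
  for q :: "'x::countable \<Rightarrow> 'x \<Rightarrow> real" and M :: "'a measure" +
  fixes x0 :: 'x and Z :: "nat \<Rightarrow> 'a \<Rightarrow> 'x" and H :: "nat \<Rightarrow> 'a \<Rightarrow> ennreal"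
  assumes Z_measurable [measurable]: "\<And>n. Z n \<in> measurable M (count_space UNIV)"
    and H_measurable [measurable]: "\<And>n. H n \<in> borel_measurable M"
    and law: "\<And>n y s. (\<And>k. 0 \<le> s k) \<Longrightarrow>
      measure M {\<omega> \<in> space M. \<forall>k\<le>n. Z k \<omega> = y k \<and> ennreal (s k) < H k \<omega>} =
        of_bool (y 0 = x0) * (\<Prod>k<n. jump_prob q (y k) (y (Suc k))) *
        (\<Prod>k\<le>n. exp (- exit_rate q (y k) * s k))"
begin

abbreviation hist :: "nat \<Rightarrow> 'a \<Rightarrow> 'x list" where
  "hist n \<omega> \<equiv> history n (\<lambda>k. Z k \<omega>)"

lemma hist_measurable [measurable]: "hist n \<in> measurable M (count_space UNIV)"
proof (induction n)
  case (Suc n)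
  have "(\<lambda>\<omega>. (\<lambda>(y, ys). y # ys) (Z (Suc n) \<omega>, hist n \<omega>)) \<in> measurable M (count_space UNIV)"
    using Suc by (intro measurable_compose[OF measurable_Pair[OF Z_measurable Suc]])
      (auto simp: measurable_pair_measure_countable1 pair_measure_countable)
  then show ?case by simp
qed simp

text \<open>The prescribed events bound holding times from below. Upper bounds on the holding times with
  index in \<open>J\<close> come from inclusion-exclusion: \<open>0 < H j \<le> s j\<close> is the event \<open>0 < H j\<close> without
  \<open>s j < H j\<close>, so each new element of \<open>J\<close> replaces one exponential by its complement.\<close>

lemma joint_law:
  assumes "finite J" "\<And>k. 0 \<le> s k"
  shows "measure M {\<omega> \<in> space M. \<forall>k\<le>n. Z k \<omega> = y k \<and>
       (if k \<in> J then 0 < H k \<omega> \<and> H k \<omega> \<le> ennreal (s k) else ennreal (s k) < H k \<omega>)} =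
    pmf (path x0 n) (history n y) *
    (\<Prod>k\<le>n. if k \<in> J then 1 - exp (- exit_rate q (y k) * s k) else exp (- exit_rate q (y k) * s k))"
  (is "measure M (?E J s) = _ * ?R J s")
  using assms
proof (induction J arbitrary: s rule: finite_induct)
  case empty
  then show ?case by (simp add: law pmf_path_history)
next
  case (insert j J)
  have ms [measurable]: "?E J s \<in> sets M" for J s by measurable
  show ?case
  proof (cases "j \<le> n")
    case False
    then have "k \<le> n \<Longrightarrow> k \<in> insert j J \<longleftrightarrow> k \<in> J" for k by auto
    then show ?thesis using insert.IH[OF insert.prems] 
      by (simp cong: conj_cong)
  next
    case True
    let ?s = "s(j := 0)"
    have eq: "?E (insert j J) s = ?E J ?s - ?E J s"
    proof (rule set_eqI)
      fix \<omega>
      let ?c = "\<lambda>J s k. Z k \<omega> = y k \<and>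
        (if k \<in> J then 0 < H k \<omega> \<and> H k \<omega> \<le> ennreal (s k) else ennreal (s k) < H k \<omega>)"
      have split: "(\<forall>k\<le>n. Q k) \<longleftrightarrow> Q j \<and> (\<forall>k\<in>{..n}-{j}. Q k)" for Q
        using True by auto
      have "(\<forall>k\<in>{..n}-{j}. ?c (insert j J) s k) \<longleftrightarrow> (\<forall>k\<in>{..n}-{j}. ?c J s k)"
        "(\<forall>k\<in>{..n}-{j}. ?c J ?s k) \<longleftrightarrow> (\<forall>k\<in>{..n}-{j}. ?c J s k)"
        by (intro ball_cong; simp)+
      moreover have "?c (insert j J) s j \<longleftrightarrow> ?c J ?s j \<and> \<not> ?c J s j"
        using insert.hyps(2) by (auto simp: not_less)
      moreover have "?c J s j \<Longrightarrow> ?c J ?s j"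
        using insert.hyps(2) by (auto intro: le_less_trans[OF zero_le])
      ultimately have "(\<forall>k\<le>n. ?c (insert j J) s k) \<longleftrightarrow> (\<forall>k\<le>n. ?c J ?s k) \<and> \<not> (\<forall>k\<le>n. ?c J s k)"
        unfolding split[of "?c (insert j J) s"] split[of "?c J s"] split[of "?c J ?s"] by argo
      then show "\<omega> \<in> ?E (insert j J) s \<longleftrightarrow> \<omega> \<in> ?E J ?s - ?E J s"
        by (simp only: mem_Collect_eq Diff_iff) argo
    qed
    have sub: "?E J s \<subseteq> ?E J ?s"
      using insert.hyps(2) by (auto intro: le_less_trans[OF zero_le] split: if_splits)
    have "measure M (?E (insert j J) s) = measure M (?E J ?s) - measure M (?E J s)"
      unfolding eq by (rule Pr.finite_measure_Diff[OF ms ms sub])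
    also have "\<dots> = pmf (path x0 n) (history n y) * (?R J ?s - ?R J s)"
      using insert.prems by (subst (1 2) insert.IH) (auto simp: algebra_simps)
    also have "?R J ?s - ?R J s = ?R (insert j J) s"
    proof -
      have R: "prod Q {..n} = Q j * prod Q ({..n} - {j})" for Q :: "nat \<Rightarrow> real"
        using True by (intro prod.remove) auto
      have "prod (\<lambda>k. if k \<in> J then 1 - exp (- exit_rate q (y k) * ?s k) else exp (- exit_rate q (y k) * ?s k)) ({..n} - {j})
        = prod (\<lambda>k. if k \<in> J then 1 - exp (- exit_rate q (y k) * s k) else exp (- exit_rate q (y k) * s k)) ({..n} - {j})"
        by (intro prod.cong) auto
      moreover have "prod (\<lambda>k. if k \<in> insert j J then 1 - exp (- exit_rate q (y k) * s k) else exp (- exit_rate q (y k) * s k)) ({..n} - {j})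
        = prod (\<lambda>k. if k \<in> J then 1 - exp (- exit_rate q (y k) * s k) else exp (- exit_rate q (y k) * s k)) ({..n} - {j})"
        by (intro prod.cong) auto
      ultimately show ?thesis unfolding R using insert.hyps(2) by (simp add: algebra_simps)
    qed
    finally show ?thesis .
  qed
qed

lemma emeasure_conv_histories:
  assumes [measurable]: "E \<in> sets M"
  shows "emeasure M E = (\<integral>\<^sup>+ys. emeasure M {\<omega> \<in> E. hist n \<omega> = ys} \<partial>count_space UNIV)"
proof -
  have "E = (\<Union>ys. {\<omega> \<in> E. hist n \<omega> = ys})" by auto
  moreover have "{\<omega> \<in> E. hist n \<omega> = ys} = {\<omega> \<in> space M. \<omega> \<in> E \<and> hist n \<omega> = ys}" for ys
    using sets.sets_into_space[OF assms] by auto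
  then have "{\<omega> \<in> E. hist n \<omega> = ys} \<in> sets M" for ys
    by (simp only:) measurable
  ultimately show ?thesis
    using emeasure_UN_countable[of UNIV "\<lambda>ys. {\<omega> \<in> E. hist n \<omega> = ys}" M]
    by (auto simp: disjoint_family_on_def)
qed

lemma emeasure_le_via_histories:
  assumes E: "E \<in> sets M" and c: "0 \<le> c"
    and "\<And>y. measure M {\<omega> \<in> E. \<forall>k\<le>n. Z k \<omega> = y k} \<le> pmf (path x0 n) (history n y) * c"
  shows "emeasure M E \<le> ennreal c"
proof -
  have le: "emeasure M {\<omega> \<in> E. hist n \<omega> = ys} \<le> ennreal (pmf (path x0 n) ys) * ennreal c" for ys
  proof (cases "length ys = Suc n")
    case True
    then obtain y where y: "ys = history n y" using history_surj by blast
    show ?thesis using assms(3)[of y] c unfolding y history_eq_iff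
      by (simp add: Pr.emeasure_eq_measure ennreal_mult[symmetric])
  next
    case False
    then have "{\<omega> \<in> E. hist n \<omega> = ys} = {}" by auto
    then show ?thesis by (simp only: emeasure_empty zero_le)
  qed
  have "emeasure M E \<le> (\<integral>\<^sup>+ys. ennreal (pmf (path x0 n) ys) * ennreal c \<partial>count_space UNIV)"
    unfolding emeasure_conv_histories[OF E, of n] by (intro nn_integral_mono le)
  also have "\<dots> = (\<integral>\<^sup>+ys. ennreal c \<partial>path x0 n)"
    by (rule nn_integral_measure_pmf[symmetric])
  finally show ?thesis by (simp add: measure_pmf.emeasure_space_1[simplified])
qed

text \<open>With all bounds equal to \<open>0\<close> the law gives each history its full weight \<open>path x0 n\<close>, and these
  weights already sum to \<open>1\<close>. Nothing is left for the event that some holding time vanishes.\<close>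

lemma AE_H_pos: "AE \<omega> in M. \<forall>n. 0 < H n \<omega>"
proof -
  have "AE \<omega> in M. 0 < H n \<omega>" for n
  proof -
    let ?E = "{\<omega> \<in> space M. \<forall>k\<le>n. 0 < H k \<omega>}"
    have eq: "emeasure M {\<omega> \<in> ?E. hist n \<omega> = ys} = ennreal (pmf (path x0 n) ys)" for ys
    proof (cases "length ys = Suc n")
      case True
      then obtain y where y: "ys = history n y" using history_surj by blast
      have "{\<omega> \<in> ?E. hist n \<omega> = ys} = {\<omega> \<in> space M. \<forall>k\<le>n. Z k \<omega> = y k \<and> ennreal 0 < H k \<omega>}"
        unfolding y history_eq_iff by auto
      then show ?thesis using law[of "\<lambda>_. 0" n y]
        by (simp add: Pr.emeasure_eq_measure y pmf_path_history)
    next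
      case False
      then have "{\<omega> \<in> ?E. hist n \<omega> = ys} = {}" by auto
      moreover have "pmf (path x0 n) ys = 0"
        using False length_path by (auto simp: pmf_eq_0_set_pmf)
      ultimately show ?thesis by (simp only: emeasure_empty ennreal_0)
    qed
    have "emeasure M ?E = (\<integral>\<^sup>+ys. ennreal (pmf (path x0 n) ys) \<partial>count_space UNIV)"
      by (subst emeasure_conv_histories[of _ n], measurable) (simp only: eq)
    also have "\<dots> = 1" by (simp add: nn_integral_pmf measure_pmf.emeasure_space_1[simplified])
    finally have "AE \<omega> in M. \<omega> \<in> ?E"
      by (intro Pr.AE_prob_1) (simp add: measure_def)
    then show ?thesis by eventually_elim auto
  qed
  then show ?thesis by (simp add: AE_all_countable)
qed

lemma emeasure_history_H:
  assumes "0 \<le> s"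
  shows "emeasure M {\<omega> \<in> space M. hist n \<omega> = ys \<and> ennreal s < H n \<omega>} =
    ennreal (pmf (path x0 n) ys * exp (- exit_rate q (hd ys) * s))"
proof (cases "length ys = Suc n")
  case True
  then obtain y where y: "ys = history n y" using history_surj by blast
  let ?s = "\<lambda>k. if k = n then s else 0"
  have "emeasure M {\<omega> \<in> space M. hist n \<omega> = ys \<and> ennreal s < H n \<omega>} =
      emeasure M {\<omega> \<in> space M. \<forall>k\<le>n. Z k \<omega> = y k \<and> ennreal (?s k) < H k \<omega>}"
  proof (rule emeasure_eq_AE)
    show "AE \<omega> in M. \<omega> \<in> {\<omega> \<in> space M. hist n \<omega> = ys \<and> ennreal s < H n \<omega>} \<longleftrightarrow>
        \<omega> \<in> {\<omega> \<in> space M. \<forall>k\<le>n. Z k \<omega> = y k \<and> ennreal (?s k) < H k \<omega>}"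
      using AE_H_pos by eventually_elim (auto simp: y history_eq_iff)
  qed measurable
  also have "\<dots> = ennreal (pmf (path x0 n) ys * exp (- exit_rate q (hd ys) * s))"
  proof -
    have "(\<Prod>k\<le>n. exp (- exit_rate q (y k) * ?s k)) = (\<Prod>k\<le>n. if k = n then exp (- exit_rate q (y k) * s) else 1)"
      by (intro prod.cong) auto
    then show ?thesis using law[of ?s n y] assms
      by (simp add: Pr.emeasure_eq_measure y pmf_path_history)
  qed
  finally show ?thesis .
next
  case False
  then have "{\<omega> \<in> space M. hist n \<omega> = ys \<and> ennreal s < H n \<omega>} = {}" by auto
  moreover have "pmf (path x0 n) ys = 0"
    using False length_path by (auto simp: pmf_eq_0_set_pmf)
  ultimately show ?thesis by (simp only: emeasure_empty ennreal_0 mult_zero_left)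
qed

lemma distr_hist: "distr M (count_space UNIV) (hist n) = measure_pmf (path x0 n)"
proof (rule measure_eqI_countable[of _ UNIV])
  fix ys
  have "emeasure (distr M (count_space UNIV) (hist n)) {ys} = emeasure M {\<omega> \<in> space M. hist n \<omega> = ys}"
    by (subst emeasure_distr) (auto intro!: arg_cong[of _ _ "emeasure M"])
  also have "\<dots> = emeasure M {\<omega> \<in> space M. hist n \<omega> = ys \<and> ennreal 0 < H n \<omega>}"
    using AE_H_pos by (intro emeasure_eq_AE) auto
  also have "\<dots> = emeasure (path x0 n) {ys}"
    by (subst emeasure_history_H) (auto simp: emeasure_pmf_single)
  finally show "emeasure (distr M (count_space UNIV) (hist n)) {ys} = emeasure (path x0 n) {ys}" .
qed auto

lemma nn_integral_hist: "(\<integral>\<^sup>+\<omega>. F (hist n \<omega>) \<partial>M) = (\<integral>\<^sup>+ys. F ys \<partial>path x0 n)"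
  by (simp add: distr_hist[symmetric] nn_integral_distr)

end

section \<open>Holding times\<close>

lemma emeasure_lborel_Ici: "emeasure lborel {0::real..} = \<infinity>"
proof (rule ccontr)
  assume "emeasure lborel {0::real..} \<noteq> \<infinity>"
  then obtain n where n: "emeasure lborel {0::real..} < of_nat n"
    using ennreal_Ex_less_of_nat[of "emeasure lborel {0::real..}"] by (auto simp: top.not_eq_extremum)
  have "of_nat n = emeasure lborel {0..real n}"
    by (simp add: ennreal_of_nat_eq_real_of_nat)
  also have "\<dots> \<le> emeasure lborel {0::real..}"
    by (rule emeasure_mono) auto
  finally show False using n by simp
qed

lemma nn_integral_exp_Ici:
  assumes "0 \<le> r"
  shows "(\<integral>\<^sup>+s. ennreal (exp (- r * s)) * indicator {0..} s \<partial>lborel) = inverse (ennreal r)"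
proof (cases "r = 0")
  case True
  then show ?thesis by (simp add: emeasure_lborel_Ici)
next
  case False
  then have r: "0 < r" using assms by simp
  interpret prob_space "density lborel (exponential_density r)"
    by (rule prob_space_exponential_density[OF r])
  have "1 = (\<integral>\<^sup>+s. ennreal (exponential_density r s) \<partial>lborel)"
    using emeasure_space_1 by (simp add: emeasure_density)
  also have "\<dots> = (\<integral>\<^sup>+s. ennreal r * (ennreal (exp (- r * s)) * indicator {0..} s) \<partial>lborel)"
    using r by (intro nn_integral_cong)
      (auto simp: exponential_density_def ennreal_mult[symmetric] mult.commute split: split_indicator)
  also have "\<dots> = ennreal r * (\<integral>\<^sup>+s. ennreal (exp (- r * s)) * indicator {0..} s \<partial>lborel)"
    by (rule nn_integral_cmult) simp
  finally have "ennreal r * (\<integral>\<^sup>+s. ennreal (exp (- r * s)) * indicator {0..} s \<partial>lborel) = 1" ..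
  then have "inverse (ennreal r) = inverse (ennreal r) * (ennreal r * (\<integral>\<^sup>+s. ennreal (exp (- r * s)) * indicator {0..} s \<partial>lborel))"
    by simp
  also have "\<dots> = (\<integral>\<^sup>+s. ennreal (exp (- r * s)) * indicator {0..} s \<partial>lborel)"
    using r by (simp add: mult.assoc[symmetric] inverse_ennreal ennreal_mult[symmetric])
  finally show ?thesis ..
qed

lemma ennreal_conv_nn_integral:
  "h = (\<integral>\<^sup>+s. indicator {s. 0 \<le> s \<and> ennreal s < h} s \<partial>lborel)"
proof (cases h)
  case (real r)
  then have "{s. 0 \<le> s \<and> ennreal s < h} = {0..<r}" by (auto simp: ennreal_less_iff)
  then show ?thesis using real by simp
next
  case top
  then have "{s. 0 \<le> s \<and> ennreal s < h} = {0..}" by auto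
  then show ?thesis using top by (simp add: emeasure_lborel_Ici)
qed

context jump_law
begin

text \<open>Given the history, the mean holding time is the reciprocal exit rate: integrate the exponential
  tail in \<open>s\<close> and exchange the integrals. For exit rate \<open>0\<close> both sides are infinite if the history
  has positive probability.\<close>

lemma nn_integral_H_single:
  "(\<integral>\<^sup>+\<omega>. H n \<omega> * indicator {ys} (hist n \<omega>) \<partial>M) =
    ennreal (pmf (path x0 n) ys) * inverse (ennreal (exit_rate q (hd ys)))"
proof -
  interpret PS: pair_sigma_finite M lborel ..
  have "(\<integral>\<^sup>+\<omega>. H n \<omega> * indicator {ys} (hist n \<omega>) \<partial>M) =
      (\<integral>\<^sup>+\<omega>. \<integral>\<^sup>+s. indicator {s. 0 \<le> s \<and> ennreal s < H n \<omega>} s * indicator {ys} (hist n \<omega>) \<partial>lborel \<partial>M)"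
    by (subst ennreal_conv_nn_integral) (simp add: nn_integral_multc)
  also have "\<dots> = (\<integral>\<^sup>+s. \<integral>\<^sup>+\<omega>. indicator {s. 0 \<le> s \<and> ennreal s < H n \<omega>} s * indicator {ys} (hist n \<omega>) \<partial>M \<partial>lborel)"
    by (rule PS.Fubini'[symmetric]) measurable
  also have "\<dots> = (\<integral>\<^sup>+s. ennreal (pmf (path x0 n) ys) *
      (ennreal (exp (- exit_rate q (hd ys) * s)) * indicator {0..} s) \<partial>lborel)"
  proof (rule nn_integral_cong)
    fix s :: real
    show "(\<integral>\<^sup>+\<omega>. indicator {s. 0 \<le> s \<and> ennreal s < H n \<omega>} s * indicator {ys} (hist n \<omega>) \<partial>M) =
      ennreal (pmf (path x0 n) ys) * (ennreal (exp (- exit_rate q (hd ys) * s)) * indicator {0..} s)"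
    proof (cases "0 \<le> s")
      case True
      have "(\<integral>\<^sup>+\<omega>. indicator {s. 0 \<le> s \<and> ennreal s < H n \<omega>} s * indicator {ys} (hist n \<omega>) \<partial>M) =
        (\<integral>\<^sup>+\<omega>. indicator {\<omega> \<in> space M. hist n \<omega> = ys \<and> ennreal s < H n \<omega>} \<omega> \<partial>M)"
        using True by (intro nn_integral_cong) (auto split: split_indicator)
      also have "\<dots> = emeasure M {\<omega> \<in> space M. hist n \<omega> = ys \<and> ennreal s < H n \<omega>}"
        by (rule nn_integral_indicator) measurable
      finally show ?thesis using True by (simp add: emeasure_history_H ennreal_mult)
    qed simp
  qed
  also have "\<dots> = ennreal (pmf (path x0 n) ys) * inverse (ennreal (exit_rate q (hd ys)))"
    using nn_integral_exp_Ici[OF exit_rate_nonneg, of "hd ys"] by (simp add: nn_integral_cmult)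
  finally show ?thesis .
qed

lemma nn_integral_H:
  "(\<integral>\<^sup>+\<omega>. H n \<omega> * indicator C (hist n \<omega>) \<partial>M) =
    (\<integral>\<^sup>+ys. indicator C ys * inverse (ennreal (exit_rate q (hd ys))) \<partial>path x0 n)"
proof -
  have "(\<integral>\<^sup>+\<omega>. H n \<omega> * indicator C (hist n \<omega>) \<partial>M) =
      (\<integral>\<^sup>+\<omega>. \<integral>\<^sup>+ys. (H n \<omega> * indicator {ys} (hist n \<omega>)) * indicator C ys \<partial>count_space UNIV \<partial>M)"
  proof (rule nn_integral_cong)
    fix \<omega>
    have "(\<integral>\<^sup>+ys. (H n \<omega> * indicator {ys} (hist n \<omega>)) * indicator C ys \<partial>count_space UNIV) =
       (\<integral>\<^sup>+ys. (H n \<omega> * indicator C (hist n \<omega>)) * indicator {hist n \<omega>} ys \<partial>count_space UNIV)"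
      by (intro nn_integral_cong) (auto split: split_indicator)
    also have "\<dots> = H n \<omega> * indicator C (hist n \<omega>)"
      by (subst nn_integral_cmult_indicator) auto
    finally show "H n \<omega> * indicator C (hist n \<omega>) =
      (\<integral>\<^sup>+ys. (H n \<omega> * indicator {ys} (hist n \<omega>)) * indicator C ys \<partial>count_space UNIV)" ..
  qed
  also have "\<dots> = (\<integral>\<^sup>+ys. \<integral>\<^sup>+\<omega>. (H n \<omega> * indicator {ys} (hist n \<omega>)) * indicator C ys \<partial>M \<partial>count_space UNIV)"
    by (rule nn_integral_count_space_nn_integral) auto
  also have "\<dots> = (\<integral>\<^sup>+ys. ennreal (pmf (path x0 n) ys) *
      (indicator C ys * inverse (ennreal (exit_rate q (hd ys)))) \<partial>count_space UNIV)"
    by (simp add: nn_integral_multc nn_integral_H_single) (simp add: mult_ac)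
  also have "\<dots> = (\<integral>\<^sup>+ys. indicator C ys * inverse (ennreal (exit_rate q (hd ys))) \<partial>path x0 n)"
    by (rule nn_integral_measure_pmf[symmetric])
  finally show ?thesis .
qed

lemma AE_hist:
  assumes "\<And>ys. ys \<in> set_pmf (path x0 n) \<Longrightarrow> P ys"
  shows "AE \<omega> in M. P (hist n \<omega>)"
proof -
  have "AE ys in distr M (count_space UNIV) (hist n). P ys"
    unfolding distr_hist using assms by (simp add: AE_measure_pmf_iff)
  then show ?thesis by (subst (asm) AE_distr_iff) auto
qed

text \<open>Given the path, the holding times are independent, and each exceeds \<open>1\<close> with probability at
  least \<open>exp (- B)\<close>. The probability that \<open>n\<close> consecutive ones all fail to do so is therefore at most
  the \<open>n\<close>-th power of a number below \<open>1\<close>.\<close>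

lemma AE_large_H:
  assumes "\<And>x. exit_rate q x \<le> B"
  shows "AE \<omega> in M. \<forall>m. \<exists>k\<ge>m. 1 < H k \<omega>"
proof -
  have B: "0 \<le> B" using assms exit_rate_nonneg order_trans by blast
  let ?r = "1 - exp (- B)"
  have r: "0 \<le> ?r" "?r < 1" using B by auto
  have "AE \<omega> in M. \<exists>k\<ge>m. 1 < H k \<omega>" for m
  proof -
    let ?N = "{\<omega> \<in> space M. \<forall>k\<ge>m. H k \<omega> \<le> 1}"
    have N: "?N \<in> sets M" by measurable
    have "emeasure M ?N \<le> ennreal (?r ^ n)" for n
    proof -
      let ?J = "{m..<m+n}" and ?s = "\<lambda>k. if k \<in> {m..<m+n} then 1 else (0::real)"
      let ?E = "{\<omega> \<in> space M. \<forall>k\<le>m+n. if k \<in> ?J then 0 < H k \<omega> \<and> H k \<omega> \<le> 1 else 0 < H k \<omega>}"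
      have mE: "?E \<in> sets M" by measurable
      have "emeasure M ?N \<le> emeasure M ?E"
        using AE_H_pos by (intro emeasure_mono_AE mE) auto
      also have "\<dots> \<le> ennreal (?r ^ n)"
      proof (rule emeasure_le_via_histories[where n = "m + n"])
        fix y
        have "measure M {\<omega> \<in> ?E. \<forall>k\<le>m+n. Z k \<omega> = y k} =
            measure M {\<omega> \<in> space M. \<forall>k\<le>m+n. Z k \<omega> = y k \<and>
              (if k \<in> ?J then 0 < H k \<omega> \<and> H k \<omega> \<le> ennreal (?s k) else ennreal (?s k) < H k \<omega>)}"
          by (rule arg_cong[where f = "measure M"]) (auto split: if_splits)
        also have "\<dots> = pmf (path x0 (m+n)) (history (m+n) y) *
           (\<Prod>k\<le>m+n. if k \<in> ?J then 1 - exp (- exit_rate q (y k) * ?s k) else exp (- exit_rate q (y k) * ?s k))"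
          by (rule joint_law) auto
        also have "(\<Prod>k\<le>m+n. if k \<in> ?J then 1 - exp (- exit_rate q (y k) * ?s k) else exp (- exit_rate q (y k) * ?s k))
            = (\<Prod>k\<in>?J. 1 - exp (- exit_rate q (y k)))"
          by (rule prod.mono_neutral_cong_right) auto
        also have "pmf (path x0 (m+n)) (history (m+n) y) * \<dots> \<le> pmf (path x0 (m+n)) (history (m+n) y) * (\<Prod>k\<in>?J. ?r)"
          using assms exit_rate_nonneg by (intro mult_left_mono prod_mono) auto
        finally show "measure M {\<omega> \<in> ?E. \<forall>k\<le>m+n. Z k \<omega> = y k} \<le> pmf (path x0 (m+n)) (history (m+n) y) * ?r ^ n"
          by simp
      qed (use mE r in auto)
      finally show ?thesis .
    qed
    then have le: "measure M ?N \<le> ?r ^ n" for n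
      using r by (simp add: Pr.emeasure_eq_measure)
    have "(\<lambda>n. ?r ^ n) \<longlonglongrightarrow> 0"
      using r by (intro LIMSEQ_realpow_zero) auto
    then have "measure M ?N \<le> 0"
      by (rule LIMSEQ_le_const) (use le in auto)
    then have "emeasure M ?N = 0"
      by (simp add: Pr.emeasure_eq_measure ennreal_eq_0_iff)
    then have "AE \<omega> in M. \<omega> \<notin> ?N"
      using N by (intro AE_not_in) auto
    then show ?thesis by (rule AE_mp) (auto intro!: AE_I2 simp: not_le)
  qed
  then show ?thesis by (simp add: AE_all_countable)
qed

lemma AE_no_explosion:
  assumes "\<And>x. exit_rate q x \<le> B"
  shows "AE \<omega> in M. \<forall>t. \<exists>n. ennreal t < (\<Sum>k<n. H k \<omega>)"
  using AE_large_H[OF assms]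
proof eventually_elim
  case (elim \<omega>)
  have large: "\<exists>n. of_nat N \<le> (\<Sum>k<n. H k \<omega>)" for N
  proof (induction N)
    case (Suc N)
    then obtain n where n: "of_nat N \<le> (\<Sum>k<n. H k \<omega>)" by blast
    obtain k where k: "n \<le> k" "1 < H k \<omega>" using elim by blast
    have "of_nat (Suc N) = of_nat N + (1 :: ennreal)" by simp
    also have "\<dots> \<le> (\<Sum>k<n. H k \<omega>) + H k \<omega>"
      using n k by (intro add_mono) auto
    also have "\<dots> \<le> (\<Sum>k<k. H k \<omega>) + H k \<omega>"
      using k by (intro add_right_mono sum_mono2) auto
    finally show ?case by (intro exI[of _ "Suc k"]) simp
  qed auto
  show ?case
  proof
    fix t
    obtain N where "ennreal t < of_nat N"
      using ennreal_Ex_less_of_nat[OF ennreal_less_top] by blast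
    then show "\<exists>n. ennreal t < (\<Sum>k<n. H k \<omega>)"
      using large[of N] less_le_trans by blast
  qed
qed

end

section \<open>Expected length of an excursion\<close>

lemma ennreal_less_add_pos:
  fixes a b :: ennreal
  assumes "a < \<infinity>" "0 < b"
  shows "a < a + b"
  using assms ennreal_add_left_cancel_less[of a 0 b] by (simp add: top.not_eq_extremum)

text \<open>Adding up the holding times of the steps at which no return has happened yet gives the time of
  the first return. If there were no return at all, the sum would be the explosion time, which is
  infinite; so finiteness of the sum also proves that the chain returns.\<close>

lemma first_return_time_eq_suminf:
  fixes h :: "nat \<Rightarrow> ennreal"
  assumes fin: "(\<Sum>n. h n * indicator {ys. z \<notin> set (butlast ys)} (history n y)) < \<infinity>"
    and unb: "\<And>t. \<exists>n. ennreal t < (\<Sum>k<n. h k)"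
  shows "\<exists>n\<ge>1. y n = z \<and> (\<forall>k\<in>{1..<n}. y k \<noteq> z) \<and>
    (\<Sum>k<n. h k) = (\<Sum>n. h n * indicator {ys. z \<notin> set (butlast ys)} (history n y))"
    (is "\<exists>n\<ge>1. _ \<and> _ \<and> _ = ?R")
proof -
  let ?f = "\<lambda>n. h n * indicator {ys. z \<notin> set (butlast ys)} (history n y)"
  have f: "?f n = (if \<exists>k\<in>{1..n}. y k = z then 0 else h n)" for n
    by (simp add: mem_butlast_history split: split_indicator)
  have ex: "\<exists>n\<ge>1. y n = z"
  proof (rule ccontr)
    assume no: "\<not> (\<exists>n\<ge>1. y n = z)"
    obtain t where t: "?R = ennreal t" using fin by (cases ?R) auto
    obtain n where n: "ennreal t < (\<Sum>k<n. h k)" using unb by blast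
    have "(\<Sum>k<n. h k) = (\<Sum>k<n. ?f k)"
      using no by (intro sum.cong) (auto simp: f)
    also have "\<dots> \<le> ?R" by (rule sum_le_suminf) auto
    finally show False using n t by simp
  qed
  define n where "n = (LEAST n. 1 \<le> n \<and> y n = z)"
  have n: "1 \<le> n" "y n = z"
    using LeastI_ex[OF ex] by (auto simp: n_def)
  have before: "y k \<noteq> z" if "1 \<le> k" "k < n" for k
    using not_less_Least[of k "\<lambda>n. 1 \<le> n \<and> y n = z"] that by (auto simp: n_def)
  have "?R = (\<Sum>k<n. ?f k)"
    using n by (intro suminf_finite) (auto simp: f not_less)
  also have "\<dots> = (\<Sum>k<n. h k)"
    using before by (intro sum.cong) (auto simp: f)
  finally show ?thesis using n before by auto
qed

context jump_law
begin

text \<open>Let \<open>e n\<close> be the mean holding time in step \<open>n\<close> and \<open>a n\<close> the mean of \<open>W\<close> in step \<open>n\<close>, both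
  restricted to paths that have not returned to \<open>z\<close>. A step from a state other than \<open>z\<close> lowers \<open>W\<close>
  on average by at least the mean holding time there, so \<open>a (n + 1) + e n \<le> a n\<close>, and the sum of all
  \<open>e n\<close> with \<open>n \<ge> 1\<close> telescopes to at most \<open>a 1\<close>. The initial state may be \<open>z\<close> itself, where \<open>W\<close> need
  not decrease; this is why step \<open>0\<close> is treated apart.\<close>

lemma nn_integral_excursion_finite:
  assumes W: "\<And>y. 0 \<le> W y" and drift: "\<And>y. y \<noteq> z \<Longrightarrow> rate_generator q W y \<le> -1"
    and x0: "0 < exit_rate q x0"
  shows "(\<integral>\<^sup>+\<omega>. (\<Sum>n. H n \<omega> * indicator {ys. z \<notin> set (butlast ys)} (hist n \<omega>)) \<partial>M) < \<infinity>"
proof -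
  let ?C = "{ys. z \<notin> set (butlast ys)} :: 'x list set"
  define e where "e n = (\<integral>\<^sup>+ys. indicator ?C ys * inverse (ennreal (exit_rate q (hd ys))) \<partial>path x0 n)" for n
  define a where "a n = (\<integral>\<^sup>+ys. indicator ?C ys * ennreal (W (hd ys)) \<partial>path x0 n)" for n
  have one_step: "(\<integral>\<^sup>+y. ennreal (W y) \<partial>step x) + inverse (ennreal (exit_rate q x)) \<le> ennreal (W x)"
    if "x \<noteq> z" for x
  proof -
    have d: "rate_generator q W x \<le> -1" using drift that by simp
    then have pos: "0 < exit_rate q x" by (intro exit_rate_pos[of W]) auto
    have "0 \<le> (\<Sum>y | q x y \<noteq> 0. W y * jump_prob q x y)"
      using W by (intro sum_nonneg mult_nonneg_nonneg) (auto simp: pmf_step[symmetric])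
    then have "0 \<le> W x + rate_generator q W x / exit_rate q x"
      by (simp add: sum_jump_prob_conv_rate_generator[OF pos])
    moreover have "W x + rate_generator q W x / exit_rate q x + inverse (exit_rate q x) \<le> W x"
      using d pos by (simp add: field_simps)
    ultimately show ?thesis
      using pos by (simp add: nn_integral_step[OF W pos] inverse_ennreal ennreal_plus[symmetric] ennreal_leI
          del: ennreal_plus)
  qed
  have rec: "a (Suc n) + e n \<le> a n" if n: "1 \<le> n" for n
  proof -
    have "a (Suc n) + e n = (\<integral>\<^sup>+ys. (\<integral>\<^sup>+y. indicator ?C (y # ys) * ennreal (W y) \<partial>step (hd ys)) +
        indicator ?C ys * inverse (ennreal (exit_rate q (hd ys))) \<partial>path x0 n)"
      unfolding a_def e_def nn_integral_path_Suc list.sel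
      by (rule nn_integral_add[symmetric]) auto
    also have "\<dots> \<le> a n" unfolding a_def
    proof (rule nn_integral_mono_AE, unfold AE_measure_pmf_iff, rule ballI)
      fix ys assume "ys \<in> set_pmf (path x0 n)"
      then have len: "length ys = Suc n" by (rule length_path)
      show "(\<integral>\<^sup>+y. indicator ?C (y # ys) * ennreal (W y) \<partial>step (hd ys)) +
          indicator ?C ys * inverse (ennreal (exit_rate q (hd ys))) \<le> indicator ?C ys * ennreal (W (hd ys))"
      proof (cases "ys \<in> ?C")
        case True
        have "hd ys \<in> set (butlast ys)"
          using len n by (cases ys rule: list.exhaust) (auto simp: length_Suc_conv)
        then have "hd ys \<noteq> z" using True by auto
        moreover have "(\<integral>\<^sup>+y. indicator ?C (y # ys) * ennreal (W y) \<partial>step (hd ys)) \<le> (\<integral>\<^sup>+y. ennreal (W y) \<partial>step (hd ys))"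
          by (intro nn_integral_mono) (auto split: split_indicator)
        ultimately show ?thesis
          using True one_step[of "hd ys"] by (simp add: order_trans[OF add_right_mono] del: nn_integral_const)
      next
        case False
        then have "y # ys \<notin> ?C" for y using len by auto
        then show ?thesis using False by simp
      qed
    qed
    finally show ?thesis .
  qed
  have sum_le: "a (Suc N) + (\<Sum>n\<in>{1..N}. e n) \<le> a 1" for N
  proof (induction N)
    case (Suc N)
    have "a (Suc (Suc N)) + (\<Sum>n\<in>{1..Suc N}. e n) = (a (Suc (Suc N)) + e (Suc N)) + (\<Sum>n\<in>{1..N}. e n)"
      by (simp add: add_ac)
    also have "\<dots> \<le> a (Suc N) + (\<Sum>n\<in>{1..N}. e n)"
      by (intro add_right_mono rec) simp
    finally show ?case using Suc by (rule order_trans)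
  qed simp
  have "a 1 \<le> (\<integral>\<^sup>+y. ennreal (W y) \<partial>step x0)"
    unfolding a_def by (auto intro!: nn_integral_mono split: split_indicator)
  also have "\<dots> < \<infinity>"
    by (simp add: nn_integral_step[OF W x0])
  finally have a1: "a 1 < \<infinity>" .
  have "e 0 = inverse (ennreal (exit_rate q x0))"
    by (simp add: e_def)
  then have e0: "e 0 < \<infinity>" using x0 by (simp add: inverse_ennreal)
  have "(\<Sum>n. e n) \<le> e 0 + a 1"
  proof (rule suminf_le_const)
    fix N
    have "(\<Sum>n<N. e n) \<le> (\<Sum>n\<in>{0..N}. e n)" by (rule sum_mono2) auto
    also have "\<dots> = e 0 + (\<Sum>n\<in>{1..N}. e n)"
      by (simp add: sum.atLeast_Suc_atMost)
    also have "\<dots> \<le> e 0 + a 1"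
      by (intro add_left_mono order_trans[OF _ sum_le[of N]]) (simp add: add_increasing)
    finally show "(\<Sum>n<N. e n) \<le> e 0 + a 1" .
  qed auto
  also have "\<dots> < \<infinity>" using e0 a1 by simp
  finally show ?thesis
    by (subst nn_integral_suminf) (auto simp: nn_integral_H e_def)
qed

lemma AE_first_return:
  assumes "\<And>y. 0 \<le> W y" "\<And>y. y \<noteq> z \<Longrightarrow> rate_generator q W y \<le> -1"
    and "0 < exit_rate q x0" "\<And>x. exit_rate q x \<le> B"
  obtains R where "R \<in> borel_measurable M" "(\<integral>\<^sup>+\<omega>. R \<omega> \<partial>M) < \<infinity>"
    "AE \<omega> in M. R \<omega> < \<infinity> \<and> (\<exists>n\<ge>1. Z n \<omega> = z \<and> (\<forall>k\<in>{1..<n}. Z k \<omega> \<noteq> z) \<and> (\<Sum>k<n. H k \<omega>) = R \<omega>)"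
proof
  let ?R = "\<lambda>\<omega>. \<Sum>n. H n \<omega> * indicator {ys. z \<notin> set (butlast ys)} (hist n \<omega>)"
  show m: "?R \<in> borel_measurable M" by measurable
  show f: "(\<integral>\<^sup>+\<omega>. ?R \<omega> \<partial>M) < \<infinity>"
    by (rule nn_integral_excursion_finite[OF assms(1-3)])
  have "AE \<omega> in M. ?R \<omega> \<noteq> \<infinity>"
    using m f by (intro nn_integral_noteq_infinite) auto
  then show "AE \<omega> in M. ?R \<omega> < \<infinity> \<and> (\<exists>n\<ge>1. Z n \<omega> = z \<and> (\<forall>k\<in>{1..<n}. Z k \<omega> \<noteq> z) \<and> (\<Sum>k<n. H k \<omega>) = ?R \<omega>)"
    using AE_no_explosion[OF assms(4)]
  proof eventually_elim
    case (elim \<omega>)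
    then show ?case
      using first_return_time_eq_suminf[of "\<lambda>n. H n \<omega>" z "\<lambda>n. Z n \<omega>"]
      by (auto simp: top.not_eq_extremum)
  qed
qed

lemma AE_start: "AE \<omega> in M. Z 0 \<omega> = x0"
  using AE_hist[of 0 "\<lambda>ys. hd ys = x0"] by simp

lemma AE_hits:
  assumes "\<And>y. 0 \<le> W y" "\<And>y. y \<noteq> z \<Longrightarrow> rate_generator q W y \<le> -1"
    and B: "\<And>x. exit_rate q x \<le> B"
    and X: "AE \<omega> in M. \<forall>t\<ge>0. \<forall>n. (\<Sum>k<n. H k \<omega>) \<le> ennreal t \<and> ennreal t < (\<Sum>k<Suc n. H k \<omega>) \<longrightarrow> \<xi> t \<omega> = Z n \<omega>"
  shows "AE \<omega> in M. \<exists>t\<ge>0. \<xi> t \<omega> = z"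
proof (cases "x0 = z")
  case True
  show ?thesis using X AE_H_pos AE_start
  proof eventually_elim
    case (elim \<omega>)
    have "\<xi> 0 \<omega> = Z 0 \<omega>"
      using elim(1)[rule_format, of 0 0] elim(2) by simp
    then show ?case using elim True by auto
  qed
next
  case False
  then have x0: "0 < exit_rate q x0"
    using assms(2)[of x0] by (intro exit_rate_pos[of W]) auto
  obtain R where R: "AE \<omega> in M. R \<omega> < \<infinity> \<and> (\<exists>n\<ge>1. Z n \<omega> = z \<and> (\<forall>k\<in>{1..<n}. Z k \<omega> \<noteq> z) \<and> (\<Sum>k<n. H k \<omega>) = R \<omega>)"
    by (rule AE_first_return[OF assms(1,2) x0 B])
  show ?thesis using X AE_H_pos R
  proof eventually_elim
    case (elim \<omega>)
    then obtain n where n: "Z n \<omega> = z" "(\<Sum>k<n. H k \<omega>) = R \<omega>" "R \<omega> < \<infinity>" by blast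
    then obtain t where t: "0 \<le> t" "(\<Sum>k<n. H k \<omega>) = ennreal t" by (cases "R \<omega>") auto
    have "ennreal t < (\<Sum>k<Suc n. H k \<omega>)"
      using elim(2) t(2) by (simp add: ennreal_less_add_pos)
    then have "\<xi> t \<omega> = z" using elim(1) n t by auto
    then show ?case using t by blast
  qed
qed

lemma nn_integral_return_time_finite:
  assumes "\<And>y. 0 \<le> W y" "\<And>y. y \<noteq> x0 \<Longrightarrow> rate_generator q W y \<le> -1"
    and x0: "0 < exit_rate q x0" "q x0 x0 = 0" and B: "\<And>x. exit_rate q x \<le> B"
    and X: "AE \<omega> in M. \<forall>t\<ge>0. \<forall>n. (\<Sum>k<n. H k \<omega>) \<le> ennreal t \<and> ennreal t < (\<Sum>k<Suc n. H k \<omega>) \<longrightarrow> \<xi> t \<omega> = Z n \<omega>"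
  shows "(\<integral>\<^sup>+\<omega>. return_time \<xi> x0 \<omega> \<partial>M) < \<infinity>"
proof -
  obtain R where fin: "(\<integral>\<^sup>+\<omega>. R \<omega> \<partial>M) < \<infinity>" and
    R: "AE \<omega> in M. R \<omega> < \<infinity> \<and> (\<exists>n\<ge>1. Z n \<omega> = x0 \<and> (\<forall>k\<in>{1..<n}. Z k \<omega> \<noteq> x0) \<and> (\<Sum>k<n. H k \<omega>) = R \<omega>)"
    by (rule AE_first_return[OF assms(1,2) x0(1) B])
  have "AE \<omega> in M. hd (hist 1 \<omega>) \<noteq> x0"
    by (rule AE_hist) (use x0 in \<open>auto simp: set_pmf_iff pmf_step jump_prob_def\<close>)
  then have Z1: "AE \<omega> in M. Z 1 \<omega> \<noteq> x0" by simp
  have "AE \<omega> in M. return_time \<xi> x0 \<omega> \<le> R \<omega>"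
    using X AE_H_pos R Z1
  proof eventually_elim
    case (elim \<omega>)
    let ?S = "\<lambda>n. \<Sum>k<n. H k \<omega>"
    have at: "\<xi> t \<omega> = Z n \<omega>" if "0 \<le> t" "?S n = ennreal t" for n t
    proof -
      have "ennreal t < (\<Sum>k<Suc n. H k \<omega>)"
        using elim(2) that(2) by (simp add: ennreal_less_add_pos)
      then show ?thesis using elim(1) that by auto
    qed
    obtain n where n: "1 \<le> n" "Z n \<omega> = x0" "?S n = R \<omega>" "R \<omega> < \<infinity>" using elim(3) by auto
    then have n2: "2 \<le> n" using elim(4) by (cases "n = 1") auto
    obtain t where t: "0 \<le> t" "?S n = ennreal t" using n by (cases "R \<omega>") auto
    have "?S 1 \<le> ?S n" using n by (intro sum_mono2) auto
    then have "?S 1 < \<infinity>" using n(3,4) by (simp only: le_less_trans)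
    then have "?S 1 < ?S 1 + H 1 \<omega>"
      using elim(2) by (intro ennreal_less_add_pos) auto
    also have "?S 1 + H 1 \<omega> = ?S 2" by (simp add: numeral_2_eq_2)
    also have "?S 2 \<le> ?S n" using n2 by (intro sum_mono2) auto
    finally have less: "?S 1 < ?S n" .
    then obtain s where s: "0 \<le> s" "?S 1 = ennreal s" by (cases "?S 1") (auto simp: t)
    then have "s < t" using less t by (simp add: ennreal_less_iff)
    moreover have "\<xi> s \<omega> \<noteq> x0" using at[OF s] elim(4) by simp
    moreover have "\<xi> t \<omega> = x0" using at[OF t] n by simp
    ultimately have "return_time \<xi> x0 \<omega> \<le> ennreal t"
      unfolding return_time_def using s by (intro Inf_lower) auto
    then show ?case using n t by simp
  qed
  then have "(\<integral>\<^sup>+\<omega>. return_time \<xi> x0 \<omega> \<partial>M) \<le> (\<integral>\<^sup>+\<omega>. R \<omega> \<partial>M)"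
    by (rule nn_integral_mono_AE)
  then show ?thesis using fin by (rule le_less_trans)
qed

section \<open>Leaving every state for good\<close>

lemma AE_H_finite:
  assumes "\<And>x. 0 < exit_rate q x"
  shows "AE \<omega> in M. \<forall>n. H n \<omega> < \<infinity>"
proof -
  have "AE \<omega> in M. H n \<omega> * indicator {ys} (hist n \<omega>) \<noteq> \<infinity>" for n ys
    using assms[of "hd ys"]
    by (intro nn_integral_noteq_infinite)
      (auto simp: nn_integral_H_single inverse_ennreal ennreal_mult[symmetric])
  then have "AE \<omega> in M. \<forall>n ys. H n \<omega> * indicator {ys} (hist n \<omega>) \<noteq> \<infinity>"
    by (simp add: AE_all_countable)
  then show ?thesis
  proof eventually_elim
    case (elim \<omega>)
    then have "H n \<omega> * indicator {hist n \<omega>} (hist n \<omega>) \<noteq> \<infinity>" for n by blast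
    then show ?case by (simp add: top.not_eq_extremum)
  qed
qed

text \<open>The drift condition makes the mean of \<open>g\<close> shrink at least by the factor \<open>1 - \<epsilon> / B\<close> in every jump. As
  \<open>g y > 0\<close>, Markov's inequality bounds the probability of being in \<open>y\<close> after \<open>n\<close> jumps by a
  geometric sequence, and Borel-Cantelli applies.\<close>

lemma AE_eventually_leaves:
  assumes g: "\<And>y. 0 < g y" and drift: "\<And>y. rate_generator q g y \<le> - \<epsilon> * g y" and \<epsilon>: "0 < \<epsilon>"
    and B: "\<And>x. exit_rate q x \<le> B"
  shows "AE \<omega> in M. \<exists>N. \<forall>n\<ge>N. Z n \<omega> \<noteq> y"
proof -
  have pos: "0 < exit_rate q x" for x
  proof (rule exit_rate_pos)
    have "0 < \<epsilon> * g x" using \<epsilon> g by simp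
    then show "rate_generator q g x \<noteq> 0" using drift[of x] by simp
  qed
  have Bpos: "0 < B" using pos[of x0] B[of x0] by simp
  define \<rho> where "\<rho> = 1 - \<epsilon> / B"
  have step_le: "g x + rate_generator q g x / exit_rate q x \<le> \<rho> * g x" for x
  proof -
    have "rate_generator q g x / exit_rate q x \<le> - (\<epsilon> * g x) / exit_rate q x"
      using drift[of x] pos[of x] by (intro divide_right_mono) auto
    also have "\<dots> \<le> - (\<epsilon> * g x) / B"
      using B[of x] pos[of x] \<epsilon> g[of x] by (simp add: divide_left_mono)
    finally show ?thesis by (simp add: \<rho>_def algebra_simps)
  qed
  have nn: "0 \<le> g x + rate_generator q g x / exit_rate q x" for x
    unfolding sum_jump_prob_conv_rate_generator[OF pos, symmetric]
    using g by (intro sum_nonneg mult_nonneg_nonneg) (auto simp: pmf_step[symmetric] less_imp_le)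
  have "0 \<le> \<rho> * g x0" using nn step_le order_trans by blast
  then have \<rho>: "0 \<le> \<rho>" "\<rho> < 1"
    using g[of x0] \<epsilon> Bpos by (auto simp: zero_le_mult_iff \<rho>_def)
  have le: "(\<integral>\<^sup>+ys. ennreal (g (hd ys)) \<partial>path x0 n) \<le> ennreal (\<rho> ^ n * g x0)" for n
  proof (induction n)
    case (Suc n)
    have "(\<integral>\<^sup>+ys. ennreal (g (hd ys)) \<partial>path x0 (Suc n)) =
        (\<integral>\<^sup>+ys. \<integral>\<^sup>+y. ennreal (g y) \<partial>step (hd ys) \<partial>path x0 n)"
      by (simp only: nn_integral_path_Suc list.sel)
    also have "\<dots> \<le> (\<integral>\<^sup>+ys. ennreal \<rho> * ennreal (g (hd ys)) \<partial>path x0 n)"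
      using step_le g pos \<rho>
      by (intro nn_integral_mono) (simp add: nn_integral_step less_imp_le ennreal_mult[symmetric] ennreal_leI)
    also have "\<dots> = ennreal \<rho> * (\<integral>\<^sup>+ys. ennreal (g (hd ys)) \<partial>path x0 n)"
      by (rule nn_integral_cmult) simp
    also have "\<dots> \<le> ennreal \<rho> * ennreal (\<rho> ^ n * g x0)"
      by (intro mult_left_mono Suc) simp
    also have "\<dots> = ennreal (\<rho> ^ Suc n * g x0)"
      using \<rho> g[of x0] by (simp add: ennreal_mult[symmetric] mult.assoc less_imp_le)
    finally show ?case .
  qed simp
  have prob_le: "measure M {\<omega> \<in> space M. Z n \<omega> = y} \<le> \<rho> ^ n * (g x0 / g y)" for n
  proof -
    have "ennreal (g y) * emeasure M {\<omega> \<in> space M. Z n \<omega> = y} =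
        (\<integral>\<^sup>+\<omega>. ennreal (g y) * indicator {\<omega> \<in> space M. Z n \<omega> = y} \<omega> \<partial>M)"
      by (rule nn_integral_cmult_indicator[symmetric]) measurable
    also have "\<dots> \<le> (\<integral>\<^sup>+\<omega>. ennreal (g (hd (hist n \<omega>))) \<partial>M)"
      by (intro nn_integral_mono) (auto split: split_indicator)
    also have "\<dots> \<le> ennreal (\<rho> ^ n * g x0)"
      by (subst nn_integral_hist[where F = "\<lambda>ys. ennreal (g (hd ys))"]) (rule le)
    finally have "ennreal (g y * measure M {\<omega> \<in> space M. Z n \<omega> = y}) \<le> ennreal (\<rho> ^ n * g x0)"
      unfolding Pr.emeasure_eq_measure ennreal_mult'[OF less_imp_le[OF g]] .
    moreover have "0 \<le> \<rho> ^ n * g x0"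
      using \<rho> g[of x0] by (intro mult_nonneg_nonneg) auto
    ultimately have "g y * measure M {\<omega> \<in> space M. Z n \<omega> = y} \<le> \<rho> ^ n * g x0"
      by (simp only: ennreal_le_iff)
    then show ?thesis using g[of y] by (simp add: field_simps)
  qed
  have "summable (\<lambda>n. measure M {\<omega> \<in> space M. Z n \<omega> = y})"
  proof (rule summable_comparison_test)
    show "summable (\<lambda>n. \<rho> ^ n * (g x0 / g y))"
      using \<rho> by (intro summable_mult2 summable_geometric) auto
  qed (use prob_le in auto)
  then have "AE \<omega> in M. eventually (\<lambda>n. \<omega> \<in> space M - {\<omega> \<in> space M. Z n \<omega> = y}) sequentially"
    by (intro borel_cantelli_AE1) (auto simp: Pr.emeasure_eq_measure)
  then show ?thesis
    by eventually_elim (auto simp: eventually_sequentially)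
qed

text \<open>Once the jump chain has left \<open>y\<close> for good, every later time belongs to the holding time of another
  state, since without explosion it belongs to some holding time. That moment is finite as there
  is no absorbing state.\<close>

lemma AE_bdd_above_visits:
  assumes g: "\<And>y. 0 < g y" and drift: "\<And>y. rate_generator q g y \<le> - \<epsilon> * g y" and \<epsilon>: "0 < \<epsilon>"
    and B: "\<And>x. exit_rate q x \<le> B"
    and X: "AE \<omega> in M. \<forall>t\<ge>0. \<forall>n. (\<Sum>k<n. H k \<omega>) \<le> ennreal t \<and> ennreal t < (\<Sum>k<Suc n. H k \<omega>) \<longrightarrow> \<xi> t \<omega> = Z n \<omega>"
  shows "AE \<omega> in M. bdd_above {t. 0 \<le> t \<and> \<xi> t \<omega> = y}"
proof -
  have pos: "0 < exit_rate q x" for x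
  proof (rule exit_rate_pos)
    have "0 < \<epsilon> * g x" using \<epsilon> g by simp
    then show "rate_generator q g x \<noteq> 0" using drift[of x] by simp
  qed
  show ?thesis
    using X AE_H_finite[OF pos] AE_no_explosion[OF B] AE_eventually_leaves[OF assms(1-4), of y]
  proof eventually_elim
    case (elim \<omega>)
    let ?S = "\<lambda>n. \<Sum>k<n. H k \<omega>"
    from elim(4) obtain N where N: "\<And>n. N \<le> n \<Longrightarrow> Z n \<omega> \<noteq> y" by blast
    have "?S N < \<infinity>" using elim(2) by (simp only: ennreal_sum_less_top finite_lessThan infinity_ennreal_def) blast
    then obtain b where b: "?S N = ennreal b" by (cases "?S N") auto
    have "t \<le> b" if t: "0 \<le> t" "\<xi> t \<omega> = y" for t
    proof (rule ccontr)
      assume "\<not> t \<le> b"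
      then have SN: "?S N \<le> ennreal t" unfolding b by (intro ennreal_leI) simp
      obtain n where "ennreal t < ?S n" using elim(3) by blast
      then obtain m where m: "\<not> ennreal t < ?S m" "ennreal t < ?S (Suc m)"
        using ex_least_nat_less[of "\<lambda>n. ennreal t < ?S n" n] by auto
      then have "?S m \<le> ennreal t \<and> ennreal t < ?S (Suc m)"
        by (simp only: not_less simp_thms)
      then have "\<xi> t \<omega> = Z m \<omega>" using elim(1)[rule_format, of t m] t(1) by simp
      moreover have "N \<le> m"
      proof (rule ccontr)
        assume "\<not> N \<le> m"
        then have "?S (Suc m) \<le> ?S N" by (intro sum_mono2) auto
        with SN have "?S (Suc m) \<le> ennreal t" by (rule order_trans[rotated])
        with m(2) have "ennreal t < ennreal t" by (rule less_le_trans)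
        then show False by simp
      qed
      ultimately show False using N[of m] t(2) by simp
    qed
    then show ?case by (intro bdd_aboveI[of _ b]) auto
  qed
qed

end

context jump_construction
begin

section \<open>Criteria for positive recurrence and transience\<close>

lemma rate_generator_sum:
  "rate_generator q (\<lambda>y. \<Sum>a\<in>A. f a y) x = (\<Sum>a\<in>A. rate_generator q (f a) x)"
  unfolding rate_generator_def sum_subtractf[symmetric] sum_distrib_left by (rule sum.swap)

lemma rate_generator_affine:
  "rate_generator q (\<lambda>y. f y + c * (K - g y)) x = rate_generator q f x - c * rate_generator q g x"
  unfolding rate_generator_def sum_distrib_left sum_subtractf[symmetric]
  by (intro sum.cong) (auto simp: algebra_simps)

lemma rate_le_exit_rate: "q x y \<le> exit_rate q x"
proof (cases "q x y = 0")
  case False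
  then show ?thesis
    unfolding exit_rate_sum using fin nonneg by (intro member_le_sum) auto
qed (simp add: exit_rate_nonneg)

text \<open>A bounded function that is positive at \<open>x\<close> and whose mean grows at a rate at least its own value,
  everywhere except at \<open>z\<close>. The indicator of \<open>z\<close> has this growth. To reach a predecessor \<open>x\<close> of \<open>y\<close>,
  the value at \<open>x\<close> is raised to a small \<open>\<eta>\<close>: the jump from \<open>x\<close> to \<open>y\<close> pays for it at \<open>x\<close>, and raising
  a value only helps the condition at all other states.\<close>

lemma exists_subharmonic:
  assumes "leads_to q x z"
  shows "\<exists>r. (\<forall>y. 0 \<le> r y \<and> r y \<le> 1) \<and> 0 < r x \<and> (\<forall>y. y \<noteq> z \<longrightarrow> r y \<le> rate_generator q r y)"
  using assms unfolding leads_to_def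
proof (induction rule: converse_rtranclp_induct)
  case base
  have "0 \<le> (\<Sum>v | q y v \<noteq> 0. q y v * indicator {z} v)" for y
    using nonneg by (intro sum_nonneg) auto
  then show ?case
    by (intro exI[of _ "indicator {z}"]) (auto simp: rate_generator_conv)
next
  case (step x y)
  then obtain r where r: "\<And>v. 0 \<le> r v" "\<And>v. r v \<le> 1" "0 < r y"
    "\<And>v. v \<noteq> z \<Longrightarrow> r v \<le> rate_generator q r v" by blast
  \<comment> \<open>The largest value whose growth condition at \<open>x\<close>,
    \<open>q x y * r y \<ge> (exit_rate q x + 1) * \<eta>\<close>, is met by the single jump to \<open>y\<close>.\<close>
  define \<eta> where "\<eta> = q x y * r y / (exit_rate q x + 1)"
  define r' where "r' = r(x := max (r x) \<eta>)"
  have pos: "0 < exit_rate q x + 1" using exit_rate_nonneg[of x] by simp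
  then have \<eta>: "0 < \<eta>" "\<eta> * (exit_rate q x + 1) = q x y * r y"
    using step r by (auto simp: \<eta>_def)
  have "q x y * r y \<le> (exit_rate q x + 1) * 1"
    using rate_le_exit_rate[of x y] r nonneg pos by (intro mult_mono) auto
  then have "\<eta> \<le> 1" using pos by (simp add: \<eta>_def)
  then have "\<forall>v. 0 \<le> r' v \<and> r' v \<le> 1" using r by (auto simp: r'_def le_max_iff_disj)
  moreover have "0 < r' x" using \<eta> by (simp add: r'_def)
  moreover have "r' v \<le> rate_generator q r' v" if v: "v \<noteq> z" for v
  proof -
    have ge: "(\<Sum>u | q v u \<noteq> 0. q v u * r u) \<le> (\<Sum>u | q v u \<noteq> 0. q v u * r' u)"
      using nonneg by (intro sum_mono mult_left_mono) (auto simp: r'_def)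
    show ?thesis
    proof (cases "r' v = r v")
      case True
      then show ?thesis using r(4)[OF v] ge by (simp add: rate_generator_conv)
    next
      case False
      then have [simp]: "v = x" and r'x: "r' x = \<eta>"
        by (auto simp: r'_def max_def split: if_splits)
      have "q x y * r y \<le> (\<Sum>u | q x u \<noteq> 0. q x u * r u)"
        using fin nonneg r step by (intro member_le_sum) auto
      then show ?thesis using ge \<eta>(2) r'x by (simp add: rate_generator_conv algebra_simps)
    qed
  qed
  ultimately show ?case by blast
qed

text \<open>Subtract from \<open>V\<close> a large multiple \<open>c\<close> of the sum \<open>R\<close> of the functions of \<open>exists_subharmonic\<close> for
  all \<open>x \<in> F\<close>. Away from \<open>z\<close> this never increases the drift, and on the finite set \<open>F\<close>, where
  \<open>R\<close> is bounded below, it makes the drift as negative as desired. As \<open>R \<le> card F\<close>, adding a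
  constant keeps the result nonnegative.\<close>

lemma Lyapunov_except_one_state:
  assumes V: "\<And>y. 0 \<le> V y" and F: "finite F" and drift: "\<And>y. y \<notin> F \<Longrightarrow> rate_generator q V y \<le> -1"
    and z: "\<And>x. x \<in> F \<Longrightarrow> leads_to q x z"
  shows "\<exists>W. (\<forall>y. 0 \<le> W y) \<and> (\<forall>y. y \<noteq> z \<longrightarrow> rate_generator q W y \<le> -1)"
proof -
  have "\<forall>x\<in>F. \<exists>r. (\<forall>y. 0 \<le> r y \<and> r y \<le> 1) \<and> 0 < r x \<and> (\<forall>y. y \<noteq> z \<longrightarrow> r y \<le> rate_generator q r y)"
    using exists_subharmonic z by blast
  then obtain r where r: "\<And>x y. x \<in> F \<Longrightarrow> 0 \<le> r x y" "\<And>x y. x \<in> F \<Longrightarrow> r x y \<le> 1"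
    "\<And>x. x \<in> F \<Longrightarrow> 0 < r x x" "\<And>x y. x \<in> F \<Longrightarrow> y \<noteq> z \<Longrightarrow> r x y \<le> rate_generator q (r x) y"
    by (metis (no_types, lifting))
  define R where "R = (\<lambda>y. \<Sum>x\<in>F. r x y)"
  define c where "c = (\<Sum>x\<in>F. max 0 ((rate_generator q V x + 1) / R x))"
  define W where "W = (\<lambda>y. V y + c * (real (card F) - R y))"
  have R_pos: "0 < R y" if "y \<in> F" for y
    unfolding R_def using F that r by (intro sum_pos2[of F y]) auto
  have R_nonneg: "0 \<le> R y" for y unfolding R_def using r by (intro sum_nonneg) auto
  have R_le: "R y \<le> real (card F)" for y
    unfolding R_def using r sum_bounded_above[of F "\<lambda>x. r x y" 1] by simp
  have c: "0 \<le> c" unfolding c_def by (intro sum_nonneg) auto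
  have LR: "R y \<le> rate_generator q R y" if "y \<noteq> z" for y
    unfolding R_def rate_generator_sum using r that by (intro sum_mono) auto
  have "rate_generator q W y \<le> -1" if y: "y \<noteq> z" for y
  proof -
    have "rate_generator q W y = rate_generator q V y - c * rate_generator q R y"
      unfolding W_def by (rule rate_generator_affine)
    also have "\<dots> \<le> rate_generator q V y - c * R y"
      using LR[OF y] c by (simp add: mult_left_mono)
    also have "\<dots> \<le> -1"
    proof (cases "y \<in> F")
      case True
      have "(rate_generator q V y + 1) / R y \<le> max 0 ((rate_generator q V y + 1) / R y)" by simp
      also have "\<dots> \<le> c" unfolding c_def using F True by (intro member_le_sum) auto
      finally show ?thesis using R_pos[OF True] by (simp add: field_simps)
    next
      case False
      then show ?thesis using drift[of y] c R_nonneg[of y] mult_nonneg_nonneg[of c "R y"] by linarith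
    qed
    finally show ?thesis .
  qed
  moreover have "0 \<le> W y" for y
    unfolding W_def using V c R_le by (intro add_nonneg_nonneg mult_nonneg_nonneg) auto
  ultimately show ?thesis by blast
qed

lemma markov_jump_process_jump_law:
  assumes "markov_jump_process q x M \<xi>"
  obtains Z H where "jump_law q M x Z H"
    "AE \<omega> in M. \<forall>t\<ge>0. \<forall>n. (\<Sum>k<n. H k \<omega>) \<le> ennreal t \<and> ennreal t < (\<Sum>k<Suc n. H k \<omega>) \<longrightarrow> \<xi> t \<omega> = Z n \<omega>"
proof -
  from assms obtain Z H where *: "prob_space M" "\<forall>n. Z n \<in> measurable M (count_space UNIV)"
    "\<forall>n. H n \<in> borel_measurable M"
    "\<forall>n y s. (\<forall>k. 0 \<le> s k) \<longrightarrow>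
           measure M {\<omega> \<in> space M. \<forall>k\<le>n. Z k \<omega> = y k \<and> ennreal (s k) < H k \<omega>} =
             of_bool (y 0 = x) * (\<Prod>k<n. jump_prob q (y k) (y (Suc k))) *
             (\<Prod>k\<le>n. exp (- exit_rate q (y k) * s k))"
    "AE \<omega> in M. \<forall>t\<ge>0. \<forall>n.
           (\<Sum>k<n. H k \<omega>) \<le> ennreal t \<and> ennreal t < (\<Sum>k<Suc n. H k \<omega>) \<longrightarrow> \<xi> t \<omega> = Z n \<omega>"
    unfolding markov_jump_process_def by blast
  have "jump_law q M x Z H"
    by (intro jump_law.intro jump_law_axioms.intro *(1) jump_construction_axioms) (use *(2-4) in auto)
  then show ?thesis using that *(5) by blast
qed

text \<open>The states reachable from \<open>a\<close> form the closed class. Each of its states can play the role of the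
  single exceptional state: taking \<open>x\<close> itself bounds the return time to \<open>x\<close>, and taking \<open>a\<close> shows
  that the class is entered from everywhere.\<close>

lemma positive_recurrent_chainI:
  assumes diag: "\<And>x. q x x = 0" and B: "\<And>x. exit_rate q x \<le> B"
    and V: "\<And>y. 0 \<le> V y" and F: "finite F" and drift: "\<And>y. y \<notin> F \<Longrightarrow> rate_generator q V y \<le> -1"
    and a: "\<And>x. leads_to q x a"
    and fam: "markov_jump_family q M \<xi>"
  shows "positive_recurrent_chain q M \<xi>"
  unfolding positive_recurrent_chain_def
proof (intro exI conjI ballI allI)
  let ?R = "{y. leads_to q a y}"
  have trans: "leads_to q x z" if "leads_to q x y" "leads_to q y z" for x y z
    using that unfolding leads_to_def by (rule rtranclp_trans)
  show "closed_class q ?R"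
    unfolding closed_class_def using a trans by blast
  have W: "\<exists>W. (\<forall>y. 0 \<le> W y) \<and> (\<forall>y. y \<noteq> z \<longrightarrow> rate_generator q W y \<le> -1)" if "z \<in> ?R" for z
    using Lyapunov_except_one_state[OF V F drift, of z] a trans that by blast
  show "positive_recurrent_state q M \<xi> x" if x: "x \<in> ?R" for x
  proof (cases "exit_rate q x = 0")
    case False
    then have pos: "0 < exit_rate q x" using exit_rate_nonneg[of x] by simp
    obtain W where W: "\<And>y. 0 \<le> W y" "\<And>y. y \<noteq> x \<Longrightarrow> rate_generator q W y \<le> -1"
      using W[OF x] by blast
    obtain Z H where "jump_law q (M x) x Z H" and
      X: "AE \<omega> in M x. \<forall>t\<ge>0. \<forall>n. (\<Sum>k<n. H k \<omega>) \<le> ennreal t \<and> ennreal t < (\<Sum>k<Suc n. H k \<omega>) \<longrightarrow> \<xi> t \<omega> = Z n \<omega>"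
      using fam unfolding markov_jump_family_def by (blast elim: markov_jump_process_jump_law)
    then interpret L: jump_law q "M x" x Z H by simp
    have "(\<integral>\<^sup>+\<omega>. return_time \<xi> x \<omega> \<partial>M x) < \<infinity>"
      by (rule L.nn_integral_return_time_finite[OF W pos diag B X])
    then show ?thesis by (simp add: positive_recurrent_state_def)
  qed (simp add: positive_recurrent_state_def)
  show "AE \<omega> in M x. \<exists>t\<ge>0. \<xi> t \<omega> \<in> ?R" for x
  proof -
    have aR: "a \<in> ?R" by (simp add: leads_to_def)
    obtain W where W: "\<And>y. 0 \<le> W y" "\<And>y. y \<noteq> a \<Longrightarrow> rate_generator q W y \<le> -1"
      using W[OF aR] by blast
    obtain Z H where "jump_law q (M x) x Z H" and
      X: "AE \<omega> in M x. \<forall>t\<ge>0. \<forall>n. (\<Sum>k<n. H k \<omega>) \<le> ennreal t \<and> ennreal t < (\<Sum>k<Suc n. H k \<omega>) \<longrightarrow> \<xi> t \<omega> = Z n \<omega>"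
      using fam unfolding markov_jump_family_def by (blast elim: markov_jump_process_jump_law)
    then interpret L: jump_law q "M x" x Z H by simp
    have "AE \<omega> in M x. \<exists>t\<ge>0. \<xi> t \<omega> = a"
      by (rule L.AE_hits[OF W B X])
    then show ?thesis by eventually_elim (use aR in auto)
  qed
qed

lemma transient_chainI:
  assumes g: "\<And>y. 0 < g y" and drift: "\<And>y. rate_generator q g y \<le> - \<epsilon> * g y" and \<epsilon>: "0 < \<epsilon>"
    and B: "\<And>x. exit_rate q x \<le> B"
    and fam: "markov_jump_family q M \<xi>"
  shows "transient_chain M \<xi>"
  unfolding transient_chain_def transient_state_def
proof
  fix x
  obtain Z H where "jump_law q (M x) x Z H" and
    X: "AE \<omega> in M x. \<forall>t\<ge>0. \<forall>n. (\<Sum>k<n. H k \<omega>) \<le> ennreal t \<and> ennreal t < (\<Sum>k<Suc n. H k \<omega>) \<longrightarrow> \<xi> t \<omega> = Z n \<omega>"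
    using fam unfolding markov_jump_family_def by (blast elim: markov_jump_process_jump_law)
  then interpret L: jump_law q "M x" x Z H by simp
  show "AE \<omega> in M x. bdd_above {t. 0 \<le> t \<and> \<xi> t \<omega> = x}"
    by (rule L.AE_bdd_above_visits[OF g drift \<epsilon> B X])
qed

end

section \<open>The hierarchical minimax decomposition\<close>

definition drift_vector :: "('s::finite \<Rightarrow> 'p \<Rightarrow> real) \<Rightarrow> 'p \<Rightarrow> real ^ 's" where
  "drift_vector f p = (\<chi> j. f j p)"

lemma drift_vector_nth [simp]: "drift_vector f p $ j = f j p"
  by (simp add: drift_vector_def)

text \<open>Minimax values and critical sets depend on a set of policies only through the drift vectors of
  its members. Compactness and convexity are therefore required of these vectors. Static
  policies are arbitrary outside the active neighbourhoods and do not form a bounded set.\<close>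

definition compact_convex_drifts :: "('s::finite \<Rightarrow> 'p \<Rightarrow> real) \<Rightarrow> 'p set \<Rightarrow> bool" where
  "compact_convex_drifts f P \<longleftrightarrow>
     P \<noteq> {} \<and> compact (drift_vector f ` P) \<and> convex (drift_vector f ` P)"

lemma continuous_on_Max_coordinates:
  fixes D :: "'s::finite set"
  assumes "D \<noteq> {}"
  shows "continuous_on U (\<lambda>u :: real ^ 's. Max ((\<lambda>j. u $ j) ` D))"
  using finite[of D] assms
proof (induction D rule: finite_ne_induct)
  case (singleton j)
  show ?case by (auto intro!: continuous_intros)
next
  case (insert j D)
  then have eq: "(\<lambda>u :: real ^ 's. Max ((\<lambda>k. u $ k) ` insert j D)) =
      (\<lambda>u. max (u $ j) (Max ((\<lambda>k. u $ k) ` D)))"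
    by (auto simp: fun_eq_iff)
  show ?case unfolding eq by (intro continuous_intros insert.IH)
qed

lemma max_drift_le_iff:
  fixes D :: "'s::finite set"
  shows "D \<noteq> {} \<Longrightarrow> max_drift f D p \<le> v \<longleftrightarrow> (\<forall>j\<in>D. f j p \<le> v)"
  by (simp add: max_drift_def)

lemma minimax_attained:
  fixes f :: "'s::finite \<Rightarrow> 'p \<Rightarrow> real"
  assumes "compact_convex_drifts f P" "D \<noteq> {}"
  shows "\<exists>p\<in>P. max_drift f D p = minimax f P D" "\<And>p. p \<in> P \<Longrightarrow> minimax f P D \<le> max_drift f D p"
proof -
  let ?U = "drift_vector f ` P"
  have "\<exists>u\<in>?U. \<forall>u'\<in>?U. Max ((\<lambda>j. u $ j) ` D) \<le> Max ((\<lambda>j. u' $ j) ` D)"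
    using assms by (intro continuous_attains_inf continuous_on_Max_coordinates)
      (auto simp: compact_convex_drifts_def)
  then obtain p where p: "p \<in> P" "\<And>p'. p' \<in> P \<Longrightarrow> max_drift f D p \<le> max_drift f D p'"
    by (auto simp: max_drift_def)
  have "minimax f P D = max_drift f D p"
    unfolding minimax_def by (rule Least_equality) (use p in auto)
  then show "\<exists>p\<in>P. max_drift f D p = minimax f P D"
    "\<And>p. p \<in> P \<Longrightarrow> minimax f P D \<le> max_drift f D p"
    using p by auto
qed

text \<open>The key to the decomposition: a policy that is at most critical on a critical set \<open>C\<close> of minimal
  size is exactly critical on all of \<open>C\<close>. Otherwise mix a little of it into the policy \<open>r\<close> with
  critical set \<open>C\<close>. The drifts outside \<open>C\<close> are below the minimax value for \<open>r\<close> and stay so after a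
  small perturbation, those in \<open>C\<close> do not increase, and one of them drops; the mixture attains
  the minimax value with a smaller critical set.\<close>

lemma minimal_critical_set_rigid:
  fixes f :: "'s::finite \<Rightarrow> 'p \<Rightarrow> real"
  assumes P: "compact_convex_drifts f P" and D: "D \<noteq> {}"
    and C: "is_arg_min card (\<lambda>C. C \<in> critical_sets f P D) C"
    and p: "p \<in> P" "\<And>j. j \<in> C \<Longrightarrow> f j p \<le> minimax f P D"
  shows "\<forall>j\<in>C. f j p = minimax f P D"
proof (rule ccontr)
  let ?v = "minimax f P D"
  assume "\<not> (\<forall>j\<in>C. f j p = ?v)"
  then obtain j0 where j0: "j0 \<in> C" "f j0 p < ?v" using p(2) by force
  have "C \<in> critical_sets f P D" using C by (simp add: is_arg_min_def)
  then obtain r where r: "r \<in> P" "max_drift f D r = ?v" "C = {j \<in> D. f j r = ?v}"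
    unfolding critical_sets_def by blast
  have rD: "f j r \<le> ?v" if "j \<in> D" for j
    using r(2) that max_drift_le_iff[OF D, of f r ?v] by simp
  have "\<forall>\<^sub>F t in at_right 0. \<forall>j\<in>D - C. (1 - t) * f j r + t * f j p < ?v"
  proof (rule eventually_ball_finite, simp, rule ballI)
    fix j assume j: "j \<in> D - C"
    have "((\<lambda>t. (1 - t) * f j r + t * f j p) \<longlongrightarrow> (1 - 0) * f j r + 0 * f j p) (at_right 0)"
      by (intro tendsto_intros)
    moreover have "(1 - 0) * f j r + 0 * f j p < ?v"
      using rD[of j] j r(3) by force
    ultimately show "\<forall>\<^sub>F t in at_right 0. (1 - t) * f j r + t * f j p < ?v"
      by (rule order_tendstoD)
  qed
  moreover have "\<forall>\<^sub>F t in at_right (0::real). 0 < t \<and> t < 1"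
    using eventually_at_right_real[of 0 "1::real"] by simp
  ultimately have "\<exists>t. (\<forall>j\<in>D - C. (1 - t) * f j r + t * f j p < ?v) \<and> 0 < t \<and> t < 1"
    using eventually_happens[OF eventually_conj] by (force simp: trivial_limit_at_right_real)
  then obtain t where t: "\<And>j. j \<in> D - C \<Longrightarrow> (1 - t) * f j r + t * f j p < ?v" "0 < t" "t < 1"
    by blast
  have "(1 - t) *\<^sub>R drift_vector f r + t *\<^sub>R drift_vector f p \<in> drift_vector f ` P"
    using P t r(1) p(1) unfolding compact_convex_drifts_def by (intro convexD) auto
  then obtain m where m: "m \<in> P" "drift_vector f m = (1 - t) *\<^sub>R drift_vector f r + t *\<^sub>R drift_vector f p"
    by auto
  have fm: "f j m = (1 - t) * f j r + t * f j p" for j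
    using arg_cong[OF m(2), of "\<lambda>u. u $ j"] by simp
  have fm_C: "f j m = ?v + t * (f j p - ?v)" if "j \<in> C" for j
    using that unfolding fm r(3) by (simp add: algebra_simps)
  have le: "f j m \<le> ?v" if "j \<in> D" for j
  proof (cases "j \<in> C")
    case True
    then show ?thesis using fm_C[of j] p(2)[of j] t by (simp add: mult_nonneg_nonpos)
  next
    case False
    then show ?thesis using t(1)[of j] that by (simp add: fm)
  qed
  have "max_drift f D m = ?v"
    using le minimax_attained(2)[OF P D m(1)] by (intro antisym) (auto simp: max_drift_le_iff[OF D])
  then have "{j \<in> D. f j m = ?v} \<in> critical_sets f P D"
    unfolding critical_sets_def using m(1) by blast
  then have "card C \<le> card {j \<in> D. f j m = ?v}"
    using C by (force simp: is_arg_min_def not_less)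
  moreover have "j0 \<notin> {j \<in> D. f j m = ?v}"
    using fm_C[OF j0(1)] j0(2) t by simp
  then have "{j \<in> D. f j m = ?v} \<subset> C"
    using t(1) j0(1) by (force simp: fm)
  then have "card {j \<in> D. f j m = ?v} < card C"
    by (intro psubset_card_mono) auto
  ultimately show False by simp
qed

text \<open>Rigidity makes the minimal critical set unique, hence the definite description in \<open>cluster\<close>
  meaningful: of two such sets, the policy attaining one is at most critical on the other, so
  that each contains the other.\<close>

lemma is_arg_min_cluster:
  fixes f :: "'s::finite \<Rightarrow> 'p \<Rightarrow> real"
  assumes P: "compact_convex_drifts f P" and D: "D \<noteq> {}"
  shows "is_arg_min card (\<lambda>C. C \<in> critical_sets f P D) (cluster f P D)"
  unfolding cluster_def
proof (rule theI')
  let ?min = "is_arg_min card (\<lambda>C. C \<in> critical_sets f P D)"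
  have "critical_sets f P D \<noteq> {}"
    unfolding critical_sets_def using minimax_attained(1)[OF P D] by blast
  then have ex: "\<exists>C. ?min C"
    using ex_is_arg_min_if_finite[of "critical_sets f P D" card] by simp
  have sub: "C \<subseteq> C'" if "?min C" "?min C'" for C C'
  proof -
    have "C \<in> critical_sets f P D" "C' \<in> critical_sets f P D"
      using that by (auto simp: is_arg_min_def)
    then obtain p where p: "p \<in> P" "max_drift f D p = minimax f P D"
        "C' = {j \<in> D. f j p = minimax f P D}" and CD: "C \<subseteq> D"
      unfolding critical_sets_def by blast
    have "\<forall>j\<in>D. f j p \<le> minimax f P D"
      using p(2) max_drift_le_iff[OF D, of f p "minimax f P D"] by simp
    then have "\<forall>j\<in>C. f j p = minimax f P D"
      using CD by (intro minimal_critical_set_rigid[OF P D that(1) p(1)]) auto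
    then show ?thesis using p(3) CD by auto
  qed
  show "\<exists>!C. ?min C"
    using ex sub by (intro ex_ex1I) auto
qed

lemma cluster_witness:
  fixes f :: "'s::finite \<Rightarrow> 'p \<Rightarrow> real"
  assumes P: "compact_convex_drifts f P" and D: "D \<noteq> {}"
  shows "\<exists>p\<in>P. (\<forall>j\<in>D. f j p \<le> minimax f P D) \<and>
    cluster f P D = {j \<in> D. f j p = minimax f P D} \<and> cluster f P D \<noteq> {}"
proof -
  have "cluster f P D \<in> critical_sets f P D"
    using is_arg_min_cluster[OF P D] by (simp add: is_arg_min_def)
  then obtain p where p: "p \<in> P" "max_drift f D p = minimax f P D"
      "cluster f P D = {j \<in> D. f j p = minimax f P D}"
    unfolding critical_sets_def by blast
  have "Max ((\<lambda>j. f j p) ` D) \<in> (\<lambda>j. f j p) ` D"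
    using D by (intro Max_in) auto
  then have "cluster f P D \<noteq> {}" unfolding p(3) using p(2) by (auto simp: max_drift_def)
  moreover have "\<forall>j\<in>D. f j p \<le> minimax f P D"
    using p(2) max_drift_le_iff[OF D, of f p "minimax f P D"] by simp
  ultimately show ?thesis using p(1,3) by blast
qed

text \<open>By rigidity the maximum over the cluster can equal the minimax value only if all drifts in the
  cluster do. This turns the maximum condition into linear equations, which preserve convexity.\<close>

lemma next_stage_policies:
  fixes f :: "'s::finite \<Rightarrow> 'p \<Rightarrow> real"
  assumes P: "compact_convex_drifts f P" and D: "D \<noteq> {}"
  shows "{p \<in> P. max_drift f (cluster f P D) p = minimax f P D} =
    {p \<in> P. \<forall>j\<in>cluster f P D. f j p = minimax f P D}"
proof -
  let ?C = "cluster f P D" and ?v = "minimax f P D"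
  have C: "?C \<noteq> {}" using cluster_witness[OF P D] by blast
  have "max_drift f ?C p = ?v \<longleftrightarrow> (\<forall>j\<in>?C. f j p = ?v)" if "p \<in> P" for p
  proof
    assume "max_drift f ?C p = ?v"
    then have "\<forall>j\<in>?C. f j p \<le> ?v" using max_drift_le_iff[OF C, of f p ?v] by simp
    then show "\<forall>j\<in>?C. f j p = ?v"
      by (intro minimal_critical_set_rigid[OF P D is_arg_min_cluster[OF P D] that]) auto
  next
    assume "\<forall>j\<in>?C. f j p = ?v"
    then have "(\<lambda>j. f j p) ` ?C = {?v}" using C by auto
    then show "max_drift f ?C p = ?v" by (simp add: max_drift_def)
  qed
  then show ?thesis by blast
qed

lemma compact_convex_drifts_next_stage:
  fixes f :: "'s::finite \<Rightarrow> 'p \<Rightarrow> real"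
  assumes P: "compact_convex_drifts f P" and D: "D \<noteq> {}"
  shows "compact_convex_drifts f {p \<in> P. max_drift f (cluster f P D) p = minimax f P D}"
proof -
  let ?C = "cluster f P D" and ?v = "minimax f P D"
  let ?E = "{u :: real ^ 's. \<forall>j\<in>?C. u $ j = ?v}"
  obtain r where "r \<in> P" "?C = {j \<in> D. f j r = ?v}" using cluster_witness[OF P D] by blast
  then have "{p \<in> P. \<forall>j\<in>?C. f j p = ?v} \<noteq> {}" by blast
  moreover have "drift_vector f ` {p \<in> P. \<forall>j\<in>?C. f j p = ?v} = drift_vector f ` P \<inter> ?E"
    by auto
  moreover have "closed ?E"
    unfolding Ball_def
    by (intro closed_Collect_all closed_Collect_imp closed_Collect_eq continuous_intros) auto
  moreover have "convex ?E"
    by (rule convexI) (simp add: distrib_right[symmetric])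
  ultimately show ?thesis
    using P unfolding next_stage_policies[OF P D] compact_convex_drifts_def
    by (auto intro: compact_Int_closed convex_Int)
qed

text \<open>The witness of a cluster survives into the next stage and keeps all drifts outside the cluster
  at or below the current value. So the minimax values never rise above the first one.\<close>

lemma decomposition_invariant:
  fixes f :: "'s::finite \<Rightarrow> 'p \<Rightarrow> real"
  assumes P0: "compact_convex_drifts f P0" and v: "minimax f P0 UNIV = v"
    and "\<And>m. m < k \<Longrightarrow> snd (decomposition f P0 m) \<noteq> {}"
    and "decomposition f P0 k = (P, D)"
  shows "compact_convex_drifts f P \<and> (\<exists>p\<in>P. \<forall>j\<in>D. f j p \<le> v) \<and> (\<forall>p\<in>P. \<forall>j. j \<notin> D \<longrightarrow> f j p \<le> v)"
  using assms(3,4)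
proof (induction k arbitrary: P D)
  case 0
  have "\<exists>p\<in>P0. \<forall>j. f j p \<le> v"
    using cluster_witness[OF P0 UNIV_not_empty] unfolding v by blast
  then show ?case using 0 P0 by simp
next
  case (Suc k)
  obtain P' D' where k: "decomposition f P0 k = (P', D')" by (cases "decomposition f P0 k")
  have D': "D' \<noteq> {}" using Suc.prems(1)[of k] k by simp
  have "snd (decomposition f P0 m) \<noteq> {}" if "m < k" for m
    using Suc.prems(1)[of m] that by simp
  note IH0 = Suc.IH[OF this k]
  have IH: "compact_convex_drifts f P'" "\<exists>p\<in>P'. \<forall>j\<in>D'. f j p \<le> v"
    using IH0 by blast+
  have IH3: "\<And>p j. p \<in> P' \<Longrightarrow> j \<notin> D' \<Longrightarrow> f j p \<le> v"
    using IH0 by blast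
  let ?C = "cluster f P' D'" and ?v = "minimax f P' D'"
  have PD: "P = {p \<in> P'. max_drift f ?C p = ?v}" "D = D' - ?C"
    using Suc.prems(2) k by (auto simp: Let_def)
  have P_eq: "P = {p \<in> P'. \<forall>j\<in>?C. f j p = ?v}"
    unfolding PD(1) by (rule next_stage_policies[OF IH(1) D'])
  have cc: "compact_convex_drifts f P"
    unfolding PD(1) by (rule compact_convex_drifts_next_stage[OF IH(1) D'])
  have le: "?v \<le> v"
  proof -
    obtain p where p: "p \<in> P'" "\<forall>j\<in>D'. f j p \<le> v" using IH(2) by blast
    have "?v \<le> max_drift f D' p" by (rule minimax_attained(2)[OF IH(1) D' p(1)])
    also have "\<dots> \<le> v" using p(2) by (simp add: max_drift_le_iff[OF D'])
    finally show ?thesis .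
  qed
  obtain r where r: "r \<in> P'" "\<forall>j\<in>D'. f j r \<le> ?v" "?C = {j \<in> D'. f j r = ?v}"
    using cluster_witness[OF IH(1) D'] by blast
  have ex: "\<exists>p\<in>P. \<forall>j\<in>D. f j p \<le> v"
  proof
    show "r \<in> P" using r P_eq by blast
    show "\<forall>j\<in>D. f j r \<le> v"
      unfolding PD(2) by (blast intro: order_trans[OF bspec[OF r(2)] le])
  qed
  have "f j p \<le> v" if "p \<in> P" "j \<notin> D" for p j
  proof (cases "j \<in> D'")
    case True
    then have "j \<in> ?C" using that(2) PD(2) by blast
    then show ?thesis using that(1) le unfolding P_eq by simp
  next
    case False
    then show ?thesis using IH3[of p j] that(1) unfolding P_eq by simp
  qed
  with cc ex show ?case by blast
qed

lemma decomposition_terminates: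
  fixes f :: "'s::finite \<Rightarrow> 'p \<Rightarrow> real"
  assumes P0: "compact_convex_drifts f P0"
  shows "\<exists>k. snd (decomposition f P0 k) = {}"
proof (rule ccontr)
  assume "\<nexists>k. snd (decomposition f P0 k) = {}"
  then have ne: "snd (decomposition f P0 k) \<noteq> {}" for k by blast
  have "card (snd (decomposition f P0 k)) + k \<le> CARD('s)" for k
  proof (induction k)
    case (Suc k)
    obtain P D where k: "decomposition f P0 k = (P, D)" by (cases "decomposition f P0 k")
    have D: "D \<noteq> {}" using ne[of k] k by simp
    have "compact_convex_drifts f P"
      using decomposition_invariant[OF P0 refl ne k] by blast
    from cluster_witness[OF this D] have "D - cluster f P D \<subset> D" by blast
    then have "card (D - cluster f P D) < card D" by (intro psubset_card_mono) auto
    then show ?case using Suc k by (simp add: Let_def)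
  qed simp
  from this[of "Suc CARD('s)"] show False by simp
qed

lemma final_policies_drift_le:
  fixes f :: "'s::finite \<Rightarrow> 'p \<Rightarrow> real"
  assumes P0: "compact_convex_drifts f P0" and p: "p \<in> final_policies f P0"
  shows "f j p \<le> minimax f P0 UNIV"
proof -
  let ?K = "final_stage f P0"
  obtain P D where K: "decomposition f P0 ?K = (P, D)" by (cases "decomposition f P0 ?K")
  have "snd (decomposition f P0 ?K) = {}"
    unfolding final_stage_def by (rule LeastI_ex) (rule decomposition_terminates[OF P0])
  then have "D = {}" using K by simp
  have "snd (decomposition f P0 m) \<noteq> {}" if "m < ?K" for m
    using that unfolding final_stage_def by (rule not_less_Least)
  from decomposition_invariant[OF P0 refl this K] \<open>D = {}\<close> show ?thesis
    using p K by (simp add: final_policies_def)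
qed

lemma final_policies_subset: "final_policies f P0 \<subseteq> P0"
proof -
  have "fst (decomposition f P0 k) \<subseteq> P0" for k
  proof (induction k)
    case (Suc k)
    then show ?case by (cases "decomposition f P0 k") (auto simp: Let_def)
  qed simp
  then show ?thesis by (simp add: final_policies_def)
qed

lemma compact_finite_sums:
  fixes K :: "'i \<Rightarrow> 'v::real_normed_vector set"
  assumes "finite A" "\<And>i. i \<in> A \<Longrightarrow> compact (K i)"
  shows "compact {\<Sum>i\<in>A. v i | v. \<forall>i\<in>A. v i \<in> K i}"
  using assms
proof (induction A rule: finite_induct)
  case (insert a A)
  have "{\<Sum>i\<in>insert a A. v i | v. \<forall>i\<in>insert a A. v i \<in> K i} =
      {x + y | x y. x \<in> K a \<and> y \<in> {\<Sum>i\<in>A. v i | v. \<forall>i\<in>A. v i \<in> K i}}" (is "?L = ?R")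
  proof (intro equalityI subsetI)
    fix u assume "u \<in> ?L"
    then show "u \<in> ?R" using insert.hyps by auto
  next
    fix u assume "u \<in> ?R"
    then obtain x v where u: "x \<in> K a" "\<forall>i\<in>A. v i \<in> K i" "u = x + (\<Sum>i\<in>A. v i)" by blast
    have "(\<Sum>i\<in>A. (v(a := x)) i) = (\<Sum>i\<in>A. v i)"
      using insert.hyps by (intro sum.cong) auto
    then have "u = (\<Sum>i\<in>insert a A. (v(a := x)) i)"
      using insert.hyps u by simp
    moreover have "\<forall>i\<in>insert a A. (v(a := x)) i \<in> K i" using u by auto
    ultimately show "u \<in> ?L" by blast
  qed
  moreover have "compact ?R"
    using insert by (intro compact_sums) auto
  ultimately show ?case by simp
qed simp

lemma compact_simplex:
  "compact {u :: real ^ 's::finite. (\<forall>j. 0 \<le> u $ j) \<and> (\<Sum>j\<in>UNIV. u $ j) = 1 \<and> (\<forall>j. j \<notin> B \<longrightarrow> u $ j = 0)}"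
  (is "compact ?K")
proof -
  have "norm u \<le> 1" if "u \<in> ?K" for u
    using norm_le_l1_cart[of u] that by simp
  then have "bounded ?K" by (auto simp: bounded_iff)
  moreover have "closed ?K"
    by (intro closed_Collect_conj closed_Collect_all closed_Collect_imp closed_Collect_le
        closed_Collect_eq continuous_intros) auto
  ultimately show ?thesis by (simp add: compact_eq_bounded_closed)
qed

text \<open>Up to a translation, the set of drift vectors is a sum, over the active neighbourhoods, of
  linear images of simplices.\<close>

lemma compact_convex_drifts_static:
  fixes S :: "'i \<Rightarrow> 's::finite set"
  assumes A: "finite A" and S: "\<And>i. i \<in> A \<Longrightarrow> S i \<noteq> {}"
  shows "compact_convex_drifts (\<lambda>j p. w j * drift A lam mu j p) (static_policies A S)"
proof -
  define f where "f = (\<lambda>j p. w j * drift A lam mu j p)"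
  let ?P = "static_policies A S"
  let ?\<Delta> = "\<lambda>i. {u :: real ^ 's. (\<forall>j. 0 \<le> u $ j) \<and> (\<Sum>j\<in>UNIV. u $ j) = 1 \<and> (\<forall>j. j \<notin> S i \<longrightarrow> u $ j = 0)}"
  let ?L = "\<lambda>i (u :: real ^ 's). \<chi> j. w j * lam i * u $ j"
  let ?c = "\<chi> j. w j * mu j"
  let ?Q = "{\<Sum>i\<in>A. v i | v. \<forall>i\<in>A. v i \<in> ?L i ` ?\<Delta> i}"
  have vec: "drift_vector f p = (\<Sum>i\<in>A. ?L i (\<chi> j. p i j)) - ?c" for p
  proof (rule iffD2[OF vec_eq_iff], rule allI)
    fix j
    have "f j p = (\<Sum>i\<in>A. w j * lam i * p i j) - w j * mu j"
      unfolding f_def drift_def by (simp add: right_diff_distrib sum_distrib_left mult.assoc)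
    then show "drift_vector f p $ j = ((\<Sum>i\<in>A. ?L i (\<chi> j. p i j)) - ?c) $ j"
      by (simp add: sum_component)
  qed
  have "compact ?Q"
    using A by (intro compact_finite_sums compact_continuous_image compact_simplex continuous_intros)
  then have "compact ((\<lambda>u. u - ?c) ` ?Q)"
    by (intro compact_continuous_image continuous_intros)
  moreover have "drift_vector f ` ?P = (\<lambda>u. u - ?c) ` ?Q"
  proof (intro equalityI subsetI)
    fix u assume "u \<in> drift_vector f ` ?P"
    then obtain p where p: "p \<in> ?P" "u = drift_vector f p" by blast
    then have "\<forall>i\<in>A. ?L i (\<chi> j. p i j) \<in> ?L i ` ?\<Delta> i"
      by (intro ballI imageI) (auto simp: static_policies_def)
    then show "u \<in> (\<lambda>u. u - ?c) ` ?Q"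
      unfolding p(2) vec by (intro imageI CollectI exI[of _ "\<lambda>i. ?L i (\<chi> j. p i j)"]) simp
  next
    fix u assume "u \<in> (\<lambda>u. u - ?c) ` ?Q"
    then obtain v where v: "\<forall>i\<in>A. v i \<in> ?L i ` ?\<Delta> i" "u = (\<Sum>i\<in>A. v i) - ?c" by blast
    then have "\<forall>i\<in>A. \<exists>q. q \<in> ?\<Delta> i \<and> v i = ?L i q" by blast
    from bchoice[OF this] obtain q where q: "\<forall>i\<in>A. q i \<in> ?\<Delta> i \<and> v i = ?L i (q i)" by blast
    let ?p = "\<lambda>i j. q i $ j"
    have "?p \<in> ?P" using q unfolding static_policies_def by blast
    moreover have "(\<Sum>i\<in>A. v i) = (\<Sum>i\<in>A. ?L i (\<chi> j. ?p i j))"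
      using q by (intro sum.cong refl) simp
    then have "u = drift_vector f ?p" unfolding vec v(2) by simp
    ultimately show "u \<in> drift_vector f ` ?P" by (rule rev_image_eqI[where f = "drift_vector f"])
  qed
  ultimately have "compact (drift_vector f ` ?P)" by simp
  moreover have "convex (drift_vector f ` ?P)"
  proof (rule convexI)
    fix x y u v assume xy: "x \<in> drift_vector f ` ?P" "y \<in> drift_vector f ` ?P"
      and uv: "0 \<le> u" "0 \<le> v" "u + v = (1::real)"
    obtain p r where pr: "p \<in> ?P" "r \<in> ?P" "x = drift_vector f p" "y = drift_vector f r" using xy by blast
    let ?m = "\<lambda>i j. u * p i j + v * r i j"
    have m: "?m \<in> ?P"
      using pr(1,2) uv by (auto simp: static_policies_def sum.distrib sum_distrib_left[symmetric])
    have "f j ?m = u * f j p + v * f j r" for j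
    proof -
      have "u * f j p + v * f j r = w j * ((\<Sum>i\<in>A. lam i * ?m i j) - (u + v) * mu j)"
        by (simp add: f_def drift_def sum_distrib_left sum.distrib distrib_left distrib_right
            right_diff_distrib mult_ac)
      then show ?thesis by (simp add: uv f_def drift_def)
    qed
    then have "drift_vector f ?m = u *\<^sub>R x + v *\<^sub>R y"
      by (simp add: vec_eq_iff pr)
    then have "u *\<^sub>R x + v *\<^sub>R y = drift_vector f ?m" ..
    with m show "u *\<^sub>R x + v *\<^sub>R y \<in> drift_vector f ` ?P" by (rule rev_image_eqI[where f = "drift_vector f"])
  qed
  moreover have "?P \<noteq> {}"
  proof -
    have "\<forall>i\<in>A. \<exists>j. j \<in> S i" using S by blast
    from bchoice[OF this] obtain c where "\<forall>i\<in>A. c i \<in> S i" by blast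
    then have "(\<lambda>i j. of_bool (j = c i)) \<in> ?P" by (auto simp: static_policies_def)
    then show ?thesis by blast
  qed
  ultimately show ?thesis by (simp add: compact_convex_drifts_def f_def)
qed

section \<open>Drifts of the queue lengths\<close>

lemma sum_fun_upd:
  fixes h :: "'s::finite \<Rightarrow> 'b \<Rightarrow> 'c::ab_group_add"
  shows "(\<Sum>k\<in>UNIV. h k ((x(j := v)) k)) = (\<Sum>k\<in>UNIV. h k (x k)) + (h j v - h j (x j))"
proof -
  have "(\<Sum>k\<in>UNIV. h k ((x(j := v)) k)) = h j v + (\<Sum>k\<in>UNIV - {j}. h k ((x(j := v)) k))"
    by (subst sum.remove[of _ j]) auto
  also have "(\<Sum>k\<in>UNIV - {j}. h k ((x(j := v)) k)) = (\<Sum>k\<in>UNIV - {j}. h k (x k))"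
    by (intro sum.cong) auto
  finally show ?thesis
    by (simp add: sum.remove[of UNIV j "\<lambda>k. h k (x k)"] algebra_simps)
qed

lemma finite_bounded_states: "finite {x :: 's::finite \<Rightarrow> nat. (\<Sum>j\<in>UNIV. x j) \<le> n}"
proof (rule finite_subset)
  show "{x :: 's \<Rightarrow> nat. (\<Sum>j\<in>UNIV. x j) \<le> n} \<subseteq> PiE UNIV (\<lambda>_. {..n})"
  proof
    fix x :: "'s \<Rightarrow> nat" assume "x \<in> {x. (\<Sum>j\<in>UNIV. x j) \<le> n}"
    then have "x j \<le> n" for j
      using member_le_sum[of j UNIV x] by simp
    then show "x \<in> PiE UNIV (\<lambda>_. {..n})" by auto
  qed
qed (auto intro: finite_PiE)

locale queueing_network =
  fixes A :: "'i set" and S :: "'i \<Rightarrow> 's::finite set" and lam :: "'i \<Rightarrow> real" and mu :: "'s \<Rightarrow> real"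
    and \<pi> :: "('s \<Rightarrow> int) \<Rightarrow> 'i \<Rightarrow> 's \<Rightarrow> real"
  assumes finite_A: "finite A" and lam_nonneg: "\<And>i. i \<in> A \<Longrightarrow> 0 \<le> lam i"
    and mu_pos: "\<And>j. 0 < mu j" and policy: "routing_policy A S \<pi>"
begin

abbreviation rates :: "('s \<Rightarrow> nat) \<Rightarrow> ('s \<Rightarrow> nat) \<Rightarrow> real" where
  "rates \<equiv> queue_rates A S lam mu \<pi>"

abbreviation arr :: "('s \<Rightarrow> nat) \<Rightarrow> 's \<Rightarrow> real" where
  "arr \<equiv> arrival_rate A S lam \<pi>"

definition dep :: "('s \<Rightarrow> nat) \<Rightarrow> 's \<Rightarrow> real" where
  "dep x j = (if 1 \<le> x j then mu j else 0)"

sublocale jump_construction rates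
  by standard (use queue_rates_nonneg[OF lam_nonneg mu_pos policy] queue_rates_finite in auto)

lemma policy_props:
  assumes "i \<in> A"
  shows "0 \<le> \<pi> x i j" "(\<Sum>j\<in>UNIV. \<pi> x i j) = 1" "j \<notin> S i \<Longrightarrow> \<pi> x i j = 0"
  using policy assms by (auto simp: routing_policy_def static_policies_def)

lemma arr_eq: "arr x j = (\<Sum>i\<in>A. lam i * \<pi> (\<lambda>l. int (x l)) i j)"
  unfolding arrival_rate_def using finite_A policy_props(3)
  by (intro sum.mono_neutral_left) auto

lemma arr_nonneg: "0 \<le> arr x j"
  unfolding arr_eq using lam_nonneg policy_props(1) by (intro sum_nonneg mult_nonneg_nonneg) auto

lemma sum_arr: "(\<Sum>j\<in>UNIV. arr x j) = (\<Sum>i\<in>A. lam i)"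
  unfolding arr_eq by (subst sum.swap) (simp add: sum_distrib_left[symmetric] policy_props(2))

lemma arr_le: "arr x j \<le> (\<Sum>i\<in>A. lam i)"
  unfolding sum_arr[of x, symmetric] using arr_nonneg by (intro member_le_sum) auto

lemma dep_bounds: "0 \<le> dep x j" "dep x j \<le> mu j"
  using mu_pos[of j] by (auto simp: dep_def)

lemma sum_rates:
  "(\<Sum>y | rates x y \<noteq> 0. rates x y * h y) =
    (\<Sum>j\<in>UNIV. arr x j * h (x(j := x j + 1)) + dep x j * h (x(j := x j - 1)))"
proof -
  let ?F = "range (\<lambda>j. x(j := x j + 1)) \<union> range (\<lambda>j. x(j := x j - 1))"
  have "(\<Sum>y | rates x y \<noteq> 0. rates x y * h y) = (\<Sum>y\<in>?F. rates x y * h y)"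
  proof (rule sum.mono_neutral_left)
    have "rates x y = 0" if "y \<notin> ?F" for y
      unfolding queue_rates_def using that by (intro sum.neutral) auto
    then show "{y. rates x y \<noteq> 0} \<subseteq> ?F" by blast
  qed auto
  also have "\<dots> = (\<Sum>y\<in>?F. \<Sum>j\<in>UNIV. (if y = x(j := x j + 1) then arr x j * h y else 0) +
      (if y = x(j := x j - 1) then dep x j * h y else 0))"
    unfolding queue_rates_def sum_distrib_right
    by (intro sum.cong) (auto simp: dep_def algebra_simps)
  also have "\<dots> = (\<Sum>j\<in>UNIV. \<Sum>y\<in>?F. (if y = x(j := x j + 1) then arr x j * h y else 0) +
      (if y = x(j := x j - 1) then dep x j * h y else 0))"
    by (rule sum.swap)
  also have "\<dots> = (\<Sum>j\<in>UNIV. arr x j * h (x(j := x j + 1)) + dep x j * h (x(j := x j - 1)))"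
    by (intro sum.cong) (auto simp: sum.distrib)
  finally show ?thesis .
qed

lemma exit_rate_eq: "exit_rate rates x = (\<Sum>j\<in>UNIV. arr x j + dep x j)"
  using sum_rates[of x "\<lambda>_. 1"] by (simp add: exit_rate_sum)

lemma exit_rate_le: "exit_rate rates x \<le> (\<Sum>i\<in>A. lam i) + (\<Sum>j\<in>UNIV. mu j)"
  unfolding exit_rate_eq sum.distrib sum_arr using dep_bounds by (intro add_left_mono sum_mono) auto

lemma rate_generator_eq:
  "rate_generator rates f x =
    (\<Sum>j\<in>UNIV. arr x j * (f (x(j := x j + 1)) - f x) + dep x j * (f (x(j := x j - 1)) - f x))"
  unfolding rate_generator_def by (rule sum_rates)

lemma rates_self: "rates x x = 0"
proof -
  have "x \<noteq> x(j := x j + 1)" "1 \<le> x j \<Longrightarrow> x \<noteq> x(j := x j - 1)" for j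
    by (auto simp: fun_eq_iff)
  then show ?thesis unfolding queue_rates_def by (intro sum.neutral) auto
qed

lemma leads_to_empty: "leads_to rates x (\<lambda>_. 0)"
proof (induction "\<Sum>j\<in>UNIV. x j" arbitrary: x rule: less_induct)
  case less
  show ?case
  proof (cases "x = (\<lambda>_. 0)")
    case True
    then show ?thesis by (simp add: leads_to_def)
  next
    case False
    then obtain j where "x j \<noteq> 0" by (auto simp: fun_eq_iff)
    then have j: "1 \<le> x j" by simp
    let ?y = "x(j := x j - 1)"
    have "(\<Sum>k\<in>UNIV. ?y k) < (\<Sum>k\<in>UNIV. x k)"
      using j by (intro sum_strict_mono_ex1) auto
    then have "leads_to rates ?y (\<lambda>_. 0)" by (rule less)
    moreover have "0 < rates x ?y"
    proof -
      let ?t = "\<lambda>k. (if ?y = x(k := x k + 1) then arr x k else 0) +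
        (if 1 \<le> x k \<and> ?y = x(k := x k - 1) then mu k else 0)"
      have "0 < ?t j" using j mu_pos arr_nonneg[of x j] by (auto intro: add_nonneg_pos)
      also have "?t j \<le> rates x ?y"
        unfolding queue_rates_def using mu_pos arr_nonneg
        by (intro member_le_sum) (auto simp: less_imp_le)
      finally show ?thesis .
    qed
    ultimately show ?thesis
      unfolding leads_to_def by (rule converse_rtranclp_into_rtranclp[where r = "\<lambda>x y. 0 < rates x y", rotated])
  qed
qed

text \<open>The total queue in \<open>C\<close> goes up at rate at least \<open>a\<close> and down at rate at most \<open>b\<close>, with \<open>b < a\<close>.
  The generator maps \<open>g\<close>, the power of \<open>\<theta>\<close> with this total as exponent, to at most
  \<open>- (1 - \<theta>) (a - b / \<theta>) g\<close>, a negative multiple of \<open>g\<close> once \<open>b / a < \<theta> < 1\<close>.\<close>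

lemma transient_if_overloaded:
  assumes C: "(\<Sum>j\<in>C. mu j) < (\<Sum>i | i \<in> A \<and> S i \<subseteq> C. lam i)"
    and fam: "markov_jump_family rates M \<xi>"
  shows "transient_chain M \<xi>"
proof -
  define a where "a = (\<Sum>i | i \<in> A \<and> S i \<subseteq> C. lam i)"
  define b where "b = (\<Sum>j\<in>C. mu j)"
  have ba: "0 \<le> b" "b < a" using C mu_pos by (simp_all add: a_def b_def sum_nonneg less_imp_le)
  \<comment> \<open>The midpoint between \<open>b / a\<close> and \<open>1\<close>.\<close>
  define \<theta> where "\<theta> = (a + b) / (2 * a)"
  have \<theta>: "0 < \<theta>" "\<theta> < 1" "b < \<theta> * a" using ba by (auto simp: \<theta>_def field_simps)
  define g where "g = (\<lambda>x :: 's \<Rightarrow> nat. \<theta> ^ (\<Sum>j\<in>C. x j))"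
  define \<epsilon> where "\<epsilon> = (1 - \<theta>) * (a - b / \<theta>)"
  have up: "g (x(j := x j + 1)) = (if j \<in> C then \<theta> * g x else g x)" for x j
  proof (cases "j \<in> C")
    case True
    then have "(\<Sum>k\<in>C. (x(j := x j + 1)) k) = Suc (\<Sum>k\<in>C. x k)"
      by (simp add: sum.remove[of C j])
    then show ?thesis using True by (simp add: g_def del: fun_upd_apply)
  next
    case False
    then have "(\<Sum>k\<in>C. (x(j := x j + 1)) k) = (\<Sum>k\<in>C. x k)" by (intro sum.cong) auto
    then show ?thesis using False by (simp add: g_def del: fun_upd_apply)
  qed
  have down: "g (x(j := x j - 1)) = (if j \<in> C then g x / \<theta> else g x)" if "1 \<le> x j" for x j
    using up[of "x(j := x j - 1)" j] that \<theta> by (auto simp: field_simps)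
  have g_pos: "0 < g x" for x using \<theta> by (simp add: g_def)
  have drift: "rate_generator rates g x \<le> - \<epsilon> * g x" for x
  proof -
    have "rate_generator rates g x =
        (\<Sum>j\<in>UNIV. if j \<in> C then g x * (arr x j * (\<theta> - 1) + dep x j * (1 / \<theta> - 1)) else 0)"
      unfolding rate_generator_eq using down[of x]
      by (intro sum.cong refl) (auto simp: up[simplified] dep_def algebra_simps)
    also have "\<dots> = g x * ((\<Sum>j\<in>C. arr x j) * (\<theta> - 1) + (\<Sum>j\<in>C. dep x j) * (1 / \<theta> - 1))"
      by (simp add: sum.If_cases sum_distrib_left[symmetric] sum.distrib sum_distrib_right[symmetric])
    also have "\<dots> \<le> g x * (a * (\<theta> - 1) + b * (1 / \<theta> - 1))"
    proof (intro mult_left_mono add_mono)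
      have "a = (\<Sum>i | i \<in> A \<and> S i \<subseteq> C. lam i * (\<Sum>j\<in>C. \<pi> (\<lambda>l. int (x l)) i j))"
        unfolding a_def
      proof (intro sum.cong refl)
        fix i assume i: "i \<in> {i. i \<in> A \<and> S i \<subseteq> C}"
        have "(\<Sum>j\<in>C. \<pi> (\<lambda>l. int (x l)) i j) = (\<Sum>j\<in>UNIV. \<pi> (\<lambda>l. int (x l)) i j)"
          using i policy_props(3)[of i] by (intro sum.mono_neutral_left) auto
        then show "lam i = lam i * (\<Sum>j\<in>C. \<pi> (\<lambda>l. int (x l)) i j)"
          using i by (simp add: policy_props(2))
      qed
      also have "\<dots> \<le> (\<Sum>i\<in>A. lam i * (\<Sum>j\<in>C. \<pi> (\<lambda>l. int (x l)) i j))"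
        using finite_A lam_nonneg policy_props(1)
        by (intro sum_mono2 mult_nonneg_nonneg sum_nonneg) auto
      also have "\<dots> = (\<Sum>j\<in>C. arr x j)"
        unfolding arr_eq sum_distrib_left by (rule sum.swap)
      finally show "(\<Sum>j\<in>C. arr x j) * (\<theta> - 1) \<le> a * (\<theta> - 1)"
        using \<theta> by (simp add: mult_right_mono_neg)
      show "(\<Sum>j\<in>C. dep x j) * (1 / \<theta> - 1) \<le> b * (1 / \<theta> - 1)"
        unfolding b_def using \<theta> dep_bounds by (intro mult_right_mono sum_mono) (auto simp: field_simps)
    qed (use g_pos[of x] in auto)
    also have "\<dots> = - \<epsilon> * g x"
      using \<theta> by (simp add: \<epsilon>_def field_simps)
    finally show ?thesis .
  qed
  have "0 < \<epsilon>"
    unfolding \<epsilon>_def using \<theta> by (intro mult_pos_pos) (auto simp: field_simps)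
  then show ?thesis
    by (rule transient_chainI[OF g_pos drift _ exit_rate_le fam])
qed

text \<open>In the generator of the quadratic function the terms quadratic in the queue lengths cancel. The
  linear ones are twice the sum in the hypothesis, and the rest is bounded by a constant \<open>K\<close>. At an
  empty station there is no departure, but then the factor \<open>x j\<close> vanishes as well, so that \<open>mu j\<close>
  may stand in the linear term throughout.\<close>

lemma positive_recurrent_if_negative_drift:
  assumes w: "\<And>j. 0 < w j" and \<epsilon>: "0 < \<epsilon>"
    and neg: "\<And>x. (\<Sum>j\<in>UNIV. w j * real (x j) * (arr x j - mu j)) \<le> - \<epsilon> * (\<Sum>j\<in>UNIV. real (x j))"
    and fam: "markov_jump_family rates M \<xi>"
  shows "positive_recurrent_chain rates M \<xi>"
proof -
  define V where "V = (\<lambda>x :: 's \<Rightarrow> nat. \<Sum>j\<in>UNIV. w j * real (x j) ^ 2)"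
  define K where "K = (\<Sum>j\<in>UNIV. w j * ((\<Sum>i\<in>A. lam i) + mu j))"
  define n where "n = nat \<lceil>(K + 1) / (2 * \<epsilon>)\<rceil>"
  define F where "F = {x :: 's \<Rightarrow> nat. (\<Sum>j\<in>UNIV. x j) \<le> n}"
  have V_upd: "V (x(j := v)) - V x = w j * (real v ^ 2 - real (x j) ^ 2)" for x j v
    unfolding V_def sum_fun_upd[of "\<lambda>k v. w k * real v ^ 2"] by (simp add: algebra_simps)
  have drift: "rate_generator rates V x \<le> -1" if "x \<notin> F" for x
  proof -
    have "rate_generator rates V x =
        (\<Sum>j\<in>UNIV. 2 * (w j * real (x j) * (arr x j - mu j)) + w j * (arr x j + dep x j))"
      unfolding rate_generator_eq V_upd
    proof (intro sum.cong refl)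
      fix j
      show "arr x j * (w j * ((real (x j + 1))\<^sup>2 - (real (x j))\<^sup>2)) + dep x j * (w j * ((real (x j - 1))\<^sup>2 - (real (x j))\<^sup>2))
          = 2 * (w j * real (x j) * (arr x j - mu j)) + w j * (arr x j + dep x j)"
        by (cases "x j") (auto simp: dep_def power2_eq_square algebra_simps)
    qed
    also have "\<dots> = 2 * (\<Sum>j\<in>UNIV. w j * real (x j) * (arr x j - mu j)) + (\<Sum>j\<in>UNIV. w j * (arr x j + dep x j))"
      by (simp add: sum.distrib sum_distrib_left)
    also have "\<dots> \<le> 2 * (- \<epsilon> * (\<Sum>j\<in>UNIV. real (x j))) + K"
      unfolding K_def using neg[of x] w arr_le dep_bounds
      by (intro add_mono mult_left_mono sum_mono) (auto simp: less_imp_le)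
    also have "\<dots> \<le> -1"
    proof -
      have "(K + 1) / (2 * \<epsilon>) \<le> real n" unfolding n_def by linarith
      also have "\<dots> \<le> real (\<Sum>j\<in>UNIV. x j)"
        using that unfolding F_def by (intro of_nat_mono) simp
      finally show ?thesis using \<epsilon> by (simp add: field_simps)
    qed
    finally show ?thesis .
  qed
  have V_nonneg: "0 \<le> V x" for x
    unfolding V_def using w by (intro sum_nonneg mult_nonneg_nonneg) (auto simp: less_imp_le)
  have "finite F" unfolding F_def by (rule finite_bounded_states)
  from positive_recurrent_chainI[OF rates_self exit_rate_le V_nonneg this drift leads_to_empty fam]
  show ?thesis .
qed

end

lemma routing_policy_JLW:
  fixes S :: "'i \<Rightarrow> 's::finite set"
  assumes "\<And>i. i \<in> A \<Longrightarrow> S i \<noteq> {}"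
  shows "routing_policy A S (JLW S w)"
  unfolding routing_policy_def static_policies_def
proof (intro allI CollectI ballI conjI impI)
  fix x i j assume i: "i \<in> A"
  show "0 \<le> JLW S w x i j" by (simp add: JLW_def)
  show "JLW S w x i j = 0" if "j \<notin> S i" using that by (simp add: JLW_def shortest_def)
  have "Min ((\<lambda>l. w l * real_of_int (x l)) ` S i) \<in> (\<lambda>l. w l * real_of_int (x l)) ` S i"
    using assms[OF i] by (intro Min_in) auto
  then have "shortest S w x i \<noteq> {}" unfolding shortest_def by auto
  then have "card (shortest S w x i) \<noteq> 0" by simp
  then show "(\<Sum>j\<in>UNIV. JLW S w x i j) = 1"
    unfolding JLW_def by (simp add: sum.If_cases)
qed

text \<open>JLW gives all traffic of a neighbourhood to stations with the least weighted queue, and the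
  average of the weighted queues under any other routing is at least their minimum.\<close>

lemma JLW_workload_le:
  fixes S :: "'i \<Rightarrow> 's::finite set"
  assumes S: "\<And>i. i \<in> A \<Longrightarrow> S i \<noteq> {}" and p: "p \<in> static_policies A S" and i: "i \<in> A"
  shows "(\<Sum>j\<in>UNIV. JLW S w x i j * (w j * real_of_int (x j))) \<le> (\<Sum>j\<in>UNIV. p i j * (w j * real_of_int (x j)))"
proof -
  let ?m = "Min ((\<lambda>l. w l * real_of_int (x l)) ` S i)"
  have J: "JLW S w x \<in> static_policies A S" using routing_policy_JLW[of A S w] S by (simp add: routing_policy_def)
  have "(\<Sum>j\<in>UNIV. JLW S w x i j * (w j * real_of_int (x j))) = (\<Sum>j\<in>UNIV. JLW S w x i j * ?m)"
    by (intro sum.cong refl) (auto simp: JLW_def shortest_def)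
  also have "\<dots> = ?m" using J i by (simp add: sum_distrib_right[symmetric] static_policies_def)
  also have "\<dots> = (\<Sum>j\<in>UNIV. p i j * ?m)"
    using p i by (simp add: sum_distrib_right[symmetric] static_policies_def)
  also have "\<dots> \<le> (\<Sum>j\<in>UNIV. p i j * (w j * real_of_int (x j)))"
  proof (rule sum_mono)
    fix j
    show "p i j * ?m \<le> p i j * (w j * real_of_int (x j))"
      using p i by (cases "j \<in> S i") (auto simp: static_policies_def intro!: mult_left_mono)
  qed
  finally show ?thesis .
qed

lemma weighted_drift_sum_le:
  fixes x :: "'s::finite \<Rightarrow> nat"
  assumes "\<And>j. w j * drift A lam mu j p \<le> v"
  shows "(\<Sum>j\<in>UNIV. w j * real (x j) * ((\<Sum>i\<in>A. lam i * p i j) - mu j)) \<le> v * (\<Sum>j\<in>UNIV. real (x j))"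
proof -
  have "(\<Sum>j\<in>UNIV. w j * real (x j) * ((\<Sum>i\<in>A. lam i * p i j) - mu j)) =
      (\<Sum>j\<in>UNIV. (w j * drift A lam mu j p) * real (x j))"
    by (intro sum.cong) (auto simp: drift_def algebra_simps)
  also have "\<dots> \<le> (\<Sum>j\<in>UNIV. v * real (x j))"
    using assms by (intro sum_mono mult_right_mono) auto
  finally show ?thesis by (simp add: sum_distrib_left)
qed

text \<open>A minimizing policy \<open>p\<close> with critical set \<open>C\<close> of minimal size sends no traffic into \<open>C\<close> from a
  neighbourhood with a station \<open>k\<close> outside \<open>C\<close>: redirecting it to \<open>k\<close> would lower a drift in
  \<open>C\<close> and raise none there, against \<open>minimal_critical_set_rigid\<close>. The drift of \<open>k\<close> may become
  large, but the lemma only looks at \<open>C\<close>. Summing the positive drifts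
  over \<open>C\<close> then compares the arrivals from neighbourhoods inside \<open>C\<close> with the service rates.\<close>

lemma overloaded_cluster:
  fixes S :: "'i \<Rightarrow> 's::finite set" and w :: "'s \<Rightarrow> real"
  assumes A: "finite A" and S: "\<And>i. i \<in> A \<Longrightarrow> S i \<noteq> {}" and lam: "\<And>i. i \<in> A \<Longrightarrow> 0 < lam i"
    and w: "\<And>j. 0 < w j"
    and pos: "0 < minimax (\<lambda>j p. w j * drift A lam mu j p) (static_policies A S) UNIV"
  shows "\<exists>C. (\<Sum>j\<in>C. mu j) < (\<Sum>i | i \<in> A \<and> S i \<subseteq> C. lam i)"
proof -
  define f where "f = (\<lambda>j p. w j * drift A lam mu j p)"
  let ?P = "static_policies A S"
  let ?v = "minimax f ?P UNIV" and ?C = "cluster f ?P UNIV"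
  have cc: "compact_convex_drifts f ?P"
    unfolding f_def by (rule compact_convex_drifts_static[OF A S])
  obtain p where p: "p \<in> ?P" "\<And>j. f j p \<le> ?v" "?C = {j. f j p = ?v}" "?C \<noteq> {}"
    using cluster_witness[OF cc UNIV_not_empty] by auto
  note pp = p(1)[unfolded static_policies_def mem_Collect_eq, rule_format]
  have inside: "S i \<subseteq> ?C" if i: "i \<in> A" and j: "j \<in> ?C" "p i j \<noteq> 0" for i j
  proof (rule ccontr)
    assume "\<not> S i \<subseteq> ?C"
    then obtain k where k: "k \<in> S i" "k \<notin> ?C" by blast
    have jk: "j \<noteq> k" using j(1) k(2) by blast
    have "0 \<le> p i j" using pp[OF i] by simp
    then have pij: "0 < p i j" using j(2) by simp
    define r where "r = p(i := (p i)(j := 0, k := p i k + p i j))"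
    have "r \<in> ?P"
    proof -
      have "(\<Sum>l\<in>UNIV. ((p i)(j := 0, k := p i k + p i j)) l) = (\<Sum>l\<in>UNIV. p i l)"
        using sum_fun_upd[of "\<lambda>_ v. v" "(p i)(j := 0)" k "p i k + p i j"] sum_fun_upd[of "\<lambda>_ v. v" "p i" j 0] jk
        by simp
      then show ?thesis
        using p(1) k(1) i unfolding static_policies_def r_def by auto
    qed
    have drift_r: "drift A lam mu l r = drift A lam mu l p + lam i * (r i l - p i l)" for l
    proof -
      have "(\<Sum>i'\<in>A. lam i' * r i' l) = lam i * r i l + (\<Sum>i'\<in>A - {i}. lam i' * p i' l)"
        using A i by (subst sum.remove[of _ i]) (auto simp: r_def intro!: sum.cong)
      moreover have "(\<Sum>i'\<in>A. lam i' * p i' l) = lam i * p i l + (\<Sum>i'\<in>A - {i}. lam i' * p i' l)"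
        using A i by (rule sum.remove)
      ultimately show ?thesis by (simp add: drift_def algebra_simps)
    qed
    have f_p: "f l p = ?v" if "l \<in> ?C" for l using that p(3) by blast
    have less: "f j r < ?v"
    proof -
      have "r i j = 0" using jk by (simp add: r_def)
      then have "f j r < f j p" using w[of j] lam[OF i] pij by (simp add: f_def drift_r)
      then show ?thesis using f_p[OF j(1)] by simp
    qed
    have "f l r \<le> ?v" if l: "l \<in> ?C" for l
    proof (cases "l = j")
      case False
      have "l \<noteq> k" using l k(2) by blast
      then have "r i l = p i l" using False by (simp add: r_def)
      then have "f l r = f l p" by (simp add: f_def drift_r)
      then show ?thesis using f_p[OF l] by simp
    qed (use less in simp)
    then have "\<forall>l\<in>?C. f l r = ?v"
      by (rule minimal_critical_set_rigid[OF cc UNIV_not_empty is_arg_min_cluster[OF cc UNIV_not_empty] \<open>r \<in> ?P\<close>])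
    then show False using j(1) less by auto
  qed
  have "(\<Sum>j\<in>?C. \<Sum>i\<in>A. lam i * p i j) = (\<Sum>i\<in>A. lam i * (\<Sum>j\<in>?C. p i j))"
    unfolding sum_distrib_left by (rule sum.swap)
  also have "\<dots> = (\<Sum>i\<in>A. if S i \<subseteq> ?C then lam i else 0)"
  proof (rule sum.cong[OF refl])
    fix i assume i: "i \<in> A"
    show "lam i * (\<Sum>j\<in>?C. p i j) = (if S i \<subseteq> ?C then lam i else 0)"
    proof (cases "S i \<subseteq> ?C")
      case True
      have "(\<Sum>j\<in>?C. p i j) = (\<Sum>j\<in>UNIV. p i j)"
        using True pp[OF i] by (intro sum.mono_neutral_left) auto
      then show ?thesis using True pp[OF i] by simp
    next
      case False
      then have "(\<Sum>j\<in>?C. p i j) = 0" using inside[OF i] by (intro sum.neutral) blast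
      then show ?thesis using False by simp
    qed
  qed
  also have "\<dots> = (\<Sum>i | i \<in> A \<and> S i \<subseteq> ?C. lam i)"
    using A by (simp add: sum.inter_filter[symmetric])
  finally have eq: "(\<Sum>j\<in>?C. \<Sum>i\<in>A. lam i * p i j) = (\<Sum>i | i \<in> A \<and> S i \<subseteq> ?C. lam i)" .
  have "(\<Sum>j\<in>?C. mu j) < (\<Sum>j\<in>?C. \<Sum>i\<in>A. lam i * p i j)"
  proof (rule sum_strict_mono)
    fix j assume "j \<in> ?C"
    then have "0 < w j * drift A lam mu j p" using p(3) pos unfolding f_def by force
    then show "mu j < (\<Sum>i\<in>A. lam i * p i j)"
      using w[of j] by (simp add: zero_less_mult_iff drift_def)
  qed (use p(4) in auto)
  then show ?thesis unfolding eq by blast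
qed

theorem theorem2:
  fixes I :: "'i set" and S :: "'i \<Rightarrow> 's::finite set"
    and lam :: "'i \<Rightarrow> real" and mu w :: "'s \<Rightarrow> real"
  defines "A \<equiv> active I lam"
  defines "f \<equiv> \<lambda>j p. w j * drift A lam mu j p"
  assumes "finite I"
    and "\<And>i. i \<in> I \<Longrightarrow> S i \<noteq> {}"
    and "\<And>i. i \<in> I \<Longrightarrow> 0 \<le> lam i"
    and "\<And>j. 0 < mu j"
    and "bipartite_connected A S"
    and "\<And>j. 0 < w j"
  shows "(0 < minimax f (static_policies A S) UNIV \<longrightarrow>
            (\<forall>\<pi> (M :: ('s \<Rightarrow> nat) \<Rightarrow> 'a measure) X.
               routing_policy A S \<pi> \<longrightarrow>
               markov_jump_family (queue_rates A S lam mu \<pi>) M X \<longrightarrow>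
               transient_chain M X)) \<and>
         (minimax f (static_policies A S) UNIV < 0 \<longrightarrow>
            (\<forall>(M :: ('s \<Rightarrow> nat) \<Rightarrow> 'a measure) X.
               markov_jump_family (queue_rates A S lam mu (JLW S w)) M X \<longrightarrow>
               positive_recurrent_chain (queue_rates A S lam mu (JLW S w)) M X) \<and>
            (\<forall>p \<in> final_policies f (static_policies A S).
               \<forall>(M :: ('s \<Rightarrow> nat) \<Rightarrow> 'a measure) X.
               markov_jump_family (queue_rates A S lam mu (\<lambda>_. p)) M X \<longrightarrow>
               positive_recurrent_chain (queue_rates A S lam mu (\<lambda>_. p)) M X))"
proof -
  have A: "finite A" and S: "\<And>i. i \<in> A \<Longrightarrow> S i \<noteq> {}" and lam: "\<And>i. i \<in> A \<Longrightarrow> 0 < lam i"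
    using assms(3,4) by (auto simp: A_def active_def)
  let ?P = "static_policies A S"
  let ?v = "minimax f ?P UNIV"
  have cc: "compact_convex_drifts f ?P"
    unfolding f_def by (rule compact_convex_drifts_static[OF A S])
  have network: "queueing_network A S lam mu \<pi>" if "routing_policy A S \<pi>" for \<pi>
    using A lam assms(6) that by unfold_locales (auto simp: less_imp_le)
  show ?thesis
  proof (intro conjI impI allI ballI)
    fix \<pi> and M :: "('s \<Rightarrow> nat) \<Rightarrow> 'a measure" and X
    assume v: "0 < ?v" and pol: "routing_policy A S \<pi>"
      and fam: "markov_jump_family (queue_rates A S lam mu \<pi>) M X"
    have "\<exists>C. (\<Sum>j\<in>C. mu j) < (\<Sum>i | i \<in> A \<and> S i \<subseteq> C. lam i)"
      by (rule overloaded_cluster[OF A S lam assms(8) v[unfolded f_def]])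
    then obtain C where "(\<Sum>j\<in>C. mu j) < (\<Sum>i | i \<in> A \<and> S i \<subseteq> C. lam i)" ..
    then show "transient_chain M X"
      by (rule queueing_network.transient_if_overloaded[OF network[OF pol] _ fam])
  next
    fix M :: "('s \<Rightarrow> nat) \<Rightarrow> 'a measure" and X
    assume v: "?v < 0" and fam: "markov_jump_family (queue_rates A S lam mu (JLW S w)) M X"
    have pol: "routing_policy A S (JLW S w)" by (rule routing_policy_JLW[OF S])
    interpret Q: queueing_network A S lam mu "JLW S w" by (rule network[OF pol])
    \<comment> \<open>JLW is compared in each state with this static policy.\<close>
    obtain p where p: "p \<in> ?P" "\<And>j. f j p \<le> ?v"
      using cluster_witness[OF cc UNIV_not_empty] by blast
    have "(\<Sum>j\<in>UNIV. w j * real (x j) * (Q.arr x j - mu j)) \<le> - (- ?v) * (\<Sum>j\<in>UNIV. real (x j))" for x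
    proof -
      let ?x = "\<lambda>l. int (x l)"
      have "(\<Sum>j\<in>UNIV. w j * real (x j) * Q.arr x j) =
          (\<Sum>i\<in>A. lam i * (\<Sum>j\<in>UNIV. JLW S w ?x i j * (w j * real_of_int (?x j))))"
        unfolding Q.arr_eq sum_distrib_left by (subst sum.swap) (simp add: mult_ac)
      also have "\<dots> \<le> (\<Sum>i\<in>A. lam i * (\<Sum>j\<in>UNIV. p i j * (w j * real_of_int (?x j))))"
        using lam by (intro sum_mono mult_left_mono JLW_workload_le[OF S p(1)]) (auto simp: less_imp_le)
      also have "\<dots> = (\<Sum>j\<in>UNIV. w j * real (x j) * (\<Sum>i\<in>A. lam i * p i j))"
        unfolding sum_distrib_left by (subst sum.swap) (simp add: mult_ac)
      finally have "(\<Sum>j\<in>UNIV. w j * real (x j) * (Q.arr x j - mu j)) \<le>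
          (\<Sum>j\<in>UNIV. w j * real (x j) * ((\<Sum>i\<in>A. lam i * p i j) - mu j))"
        by (simp add: right_diff_distrib sum_subtractf)
      also have "\<dots> \<le> ?v * (\<Sum>j\<in>UNIV. real (x j))"
        using p(2) unfolding f_def by (rule weighted_drift_sum_le)
      finally show ?thesis by simp
    qed
    then show "positive_recurrent_chain (queue_rates A S lam mu (JLW S w)) M X"
      using v by (intro Q.positive_recurrent_if_negative_drift[OF assms(8) _ _ fam, of "- ?v"]) auto
  next
    fix p and M :: "('s \<Rightarrow> nat) \<Rightarrow> 'a measure" and X
    assume v: "?v < 0" and p: "p \<in> final_policies f ?P"
      and fam: "markov_jump_family (queue_rates A S lam mu (\<lambda>_. p)) M X"
    have pol: "routing_policy A S (\<lambda>_. p)"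
      using subsetD[OF final_policies_subset p] by (simp add: routing_policy_def)
    interpret Q: queueing_network A S lam mu "\<lambda>_. p" by (rule network[OF pol])
    have "(\<Sum>j\<in>UNIV. w j * real (x j) * (Q.arr x j - mu j)) \<le> - (- ?v) * (\<Sum>j\<in>UNIV. real (x j))" for x
      unfolding Q.arr_eq
      using weighted_drift_sum_le[OF final_policies_drift_le[OF cc p, unfolded f_def], of x]
      by (simp add: f_def)
    then show "positive_recurrent_chain (queue_rates A S lam mu (\<lambda>_. p)) M X"
      using v by (intro Q.positive_recurrent_if_negative_drift[OF assms(8) _ _ fam, of "- ?v"]) auto
  qed
qed

end
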